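(* Let $\varphi\in\mathfrak{G}_0$ and assume that $$\varphi(\mathbb{C}_0)\subset\left\{s\in\mathbb{C}_{1/2}:\ \left|\arg\left(s-\tfrac12\right)\right|<\frac{\pi}{2\alpha}\right\}$$ for some $\alpha>1$. Then $C_\varphi$ is compact on $\mathcal{H}^2$. If moreover $\alpha\le 2$, then $C_\varphi\in S_{2p}$ for every $p>\frac{1}{\alpha-1}$.
   Context: For $\theta\in\mathbb{R}$, $\mathbb{C}_\theta=\{s\in\mathbb{C}:\Re s>\theta\}$. $\mathcal{H}^2$ is the Hilbert space of Dirichlet series $f(s)=\sum_{n\ge1}a_n n^{-s}$ with $\|f\|^2_{\mathcal{H}^2}=\sum_{n\ge1}|a_n|^2<\infty$ (such $f$ are holomorphic in $\mathbb{C}_{1/2}$). $\mathfrak{G}_0$ is the class of (somewhere convergent) Dirichlet series $\varphi(s)=\sum_{n\ge1}c_n n^{-s}$ that define a holomorphic function on $\mathbb{C}_0$ with $\varphi(\mathbb{C}_0)\subset\mathbb{C}_{1/2}$; for such $\varphi$, $C_\varphi f=f\circ\varphi$ is a bounded operator on $\mathcal{H}^2$. For $p>0$, $S_p$ is the Schatten class of compact operators on $\mathcal{H}^2$ whose singular value sequence $(s_n)$ satisfies $\sum_n s_n^p<\infty$. *)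

theory Defs
  imports "HOL-Analysis.Analysis"
begin

section \<open>Half-planes and Dirichlet series\<close>

definition right_half_plane :: "real \<Rightarrow> complex set" where
  "right_half_plane \<theta> = {s. \<theta> < Re s}"

text \<open>
  The term with \<open>n = 0\<close> vanishes because \<open>0 powr z = 0\<close>; the series is thus indexed by \<open>n \<ge> 1\<close>.
\<close>

definition dirichlet_term :: "(nat \<Rightarrow> complex) \<Rightarrow> complex \<Rightarrow> nat \<Rightarrow> complex" where
  "dirichlet_term a s n = a n * of_nat n powr (- s)"


section \<open>The Hilbert space of Dirichlet series with square summable coefficients\<close>

text \<open>
  An element is given by its coefficient sequence, normalised by \<open>a 0 = 0\<close>.
\<close>

typedef h2 = "{a :: nat \<Rightarrow> complex. a 0 = 0 \<and> summable (\<lambda>n. (cmod (a n))\<^sup>2)}"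
  morphisms h2_coeff Abs_h2
  by (rule exI[of _ "\<lambda>_. 0"]) simp

definition h2_eval :: "h2 \<Rightarrow> complex \<Rightarrow> complex" where
  "h2_eval f s = (\<Sum>n. dirichlet_term (h2_coeff f) s n)"

lemma h2_coeff_0 [simp]: "h2_coeff f 0 = 0"
  using h2_coeff[of f] by simp

lemma summable_h2_coeff: "summable (\<lambda>n. (cmod (h2_coeff f n))\<^sup>2)"
  using h2_coeff[of f] by simp

lemma h2_eqI: "(\<And>n. h2_coeff f n = h2_coeff g n) \<Longrightarrow> f = g"
  by (metis ext h2_coeff_inject)

lemma summable_square_add:
  fixes a b :: "nat \<Rightarrow> complex"
  assumes "summable (\<lambda>n. (cmod (a n))\<^sup>2)" "summable (\<lambda>n. (cmod (b n))\<^sup>2)"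
  shows "summable (\<lambda>n. (cmod (a n + b n))\<^sup>2)"
proof (rule summable_comparison_test')
  show "summable (\<lambda>n. 2 * (cmod (a n))\<^sup>2 + 2 * (cmod (b n))\<^sup>2)"
    by (intro summable_add summable_mult assms)
  fix n :: nat
  have "(cmod (a n + b n))\<^sup>2 \<le> (cmod (a n) + cmod (b n))\<^sup>2"
    by (intro power_mono norm_triangle_ineq) auto
  also have "\<dots> \<le> 2 * (cmod (a n))\<^sup>2 + 2 * (cmod (b n))\<^sup>2"
    using sum_squares_bound[of "cmod (a n)" "cmod (b n)"] by (simp add: power2_sum)
  finally show "norm ((cmod (a n + b n))\<^sup>2) \<le> 2 * (cmod (a n))\<^sup>2 + 2 * (cmod (b n))\<^sup>2"
    by simp
qed

lemma summable_square_scale: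
  fixes a :: "nat \<Rightarrow> complex"
  assumes "summable (\<lambda>n. (cmod (a n))\<^sup>2)"
  shows "summable (\<lambda>n. (cmod (c * a n))\<^sup>2)"
  by (simp add: norm_mult power_mult_distrib summable_mult assms)

definition h2_scaleC :: "complex \<Rightarrow> h2 \<Rightarrow> h2" where
  "h2_scaleC c f = Abs_h2 (\<lambda>n. c * h2_coeff f n)"

lemma h2_coeff_scaleC [simp]: "h2_coeff (h2_scaleC c f) n = c * h2_coeff f n"
  unfolding h2_scaleC_def
  by (subst Abs_h2_inverse) (auto intro: summable_square_scale summable_h2_coeff)

definition h2_cinner :: "h2 \<Rightarrow> h2 \<Rightarrow> complex" where
  "h2_cinner f g = (\<Sum>n. h2_coeff f n * cnj (h2_coeff g n))"

lemma summable_h2_cinner: "summable (\<lambda>n. h2_coeff f n * cnj (h2_coeff g n))"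
proof (rule summable_comparison_test')
  show "summable (\<lambda>n. (cmod (h2_coeff f n))\<^sup>2 + (cmod (h2_coeff g n))\<^sup>2)"
    by (intro summable_add summable_h2_coeff)
  fix n :: nat
  have "0 \<le> cmod (h2_coeff f n) * cmod (h2_coeff g n)"
    by simp
  then show "norm (h2_coeff f n * cnj (h2_coeff g n)) \<le>
      (cmod (h2_coeff f n))\<^sup>2 + (cmod (h2_coeff g n))\<^sup>2"
    using sum_squares_bound[of "cmod (h2_coeff f n)" "cmod (h2_coeff g n)"]
    unfolding norm_mult complex_mod_cnj by linarith
qed

instantiation h2 :: real_vector
begin

definition zero_h2 :: h2 where
  "0 = Abs_h2 (\<lambda>_. 0)"

definition plus_h2 :: "h2 \<Rightarrow> h2 \<Rightarrow> h2" where
  "f + g = Abs_h2 (\<lambda>n. h2_coeff f n + h2_coeff g n)"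

definition uminus_h2 :: "h2 \<Rightarrow> h2" where
  "- f = h2_scaleC (- 1) f"

definition minus_h2 :: "h2 \<Rightarrow> h2 \<Rightarrow> h2" where
  "f - g = f + - (g :: h2)"

definition scaleR_h2 :: "real \<Rightarrow> h2 \<Rightarrow> h2" where
  "r *\<^sub>R f = h2_scaleC (of_real r) f"

lemma h2_coeff_zero: "h2_coeff 0 n = 0"
  unfolding zero_h2_def by (subst Abs_h2_inverse) auto

lemma h2_coeff_plus: "h2_coeff (f + g) n = h2_coeff f n + h2_coeff g n"
  unfolding plus_h2_def
  by (subst Abs_h2_inverse) (auto intro: summable_square_add summable_h2_coeff)

instance
proof
  fix f g h :: h2 and r q :: real
  note coeffs = h2_coeff_zero h2_coeff_plus uminus_h2_def minus_h2_def scaleR_h2_def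
  show "f + g + h = f + (g + h)" "f + g = g + f" "0 + f = f" "- f + f = 0" "f - g = f + - g"
    "r *\<^sub>R (f + g) = r *\<^sub>R f + r *\<^sub>R g" "(r + q) *\<^sub>R f = r *\<^sub>R f + q *\<^sub>R f"
    "r *\<^sub>R q *\<^sub>R f = (r * q) *\<^sub>R f" "1 *\<^sub>R f = f"
    by (auto intro!: h2_eqI simp: coeffs algebra_simps)
qed

end

instantiation h2 :: real_inner
begin

definition inner_h2 :: "h2 \<Rightarrow> h2 \<Rightarrow> real" where
  "inner f g = Re (h2_cinner f g)"

definition norm_h2 :: "h2 \<Rightarrow> real" where
  "norm (f :: h2) = sqrt (\<Sum>n. (cmod (h2_coeff f n))\<^sup>2)"

definition sgn_h2 :: "h2 \<Rightarrow> h2" where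
  "sgn (f :: h2) = f /\<^sub>R norm f"

definition dist_h2 :: "h2 \<Rightarrow> h2 \<Rightarrow> real" where
  "dist f g = norm (f - g :: h2)"

definition uniformity_h2 :: "(h2 \<times> h2) filter" where
  "uniformity = (INF e\<in>{0<..}. principal {(f :: h2, g). dist f g < e})"

definition open_h2 :: "h2 set \<Rightarrow> bool" where
  "open (U :: h2 set) = (\<forall>f\<in>U. eventually (\<lambda>(f', g). f' = f \<longrightarrow> g \<in> U) uniformity)"

lemma inner_h2_suminf: "inner f g = (\<Sum>n. Re (h2_coeff f n * cnj (h2_coeff g n)))"
  unfolding inner_h2_def h2_cinner_def by (rule Re_suminf[OF summable_h2_cinner])

lemma summable_inner_h2: "summable (\<lambda>n. Re (h2_coeff f n * cnj (h2_coeff g n)))"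
  by (intro summable_Re summable_h2_cinner)

lemma inner_h2_self: "inner f f = (\<Sum>n. (cmod (h2_coeff f n))\<^sup>2)"
  unfolding inner_h2_suminf unfolding cmod_power2 by (simp add: power2_eq_square)

instance
proof
  fix f g h :: h2 and r :: real
  show "dist f g = norm (f - g)" by (rule dist_h2_def)
  show "sgn f = f /\<^sub>R norm f" by (rule sgn_h2_def)
  show "uniformity = (INF e\<in>{0<..}. principal {(f :: h2, g). dist f g < e})"
    by (rule uniformity_h2_def)
  show "open U = (\<forall>f\<in>U. \<forall>\<^sub>F (f', g) in uniformity. f' = f \<longrightarrow> g \<in> U)" for U :: "h2 set"
    by (rule open_h2_def)
  show "inner f g = inner g f"
    unfolding inner_h2_suminf by (simp add: algebra_simps)
  show "inner (f + g) h = inner f h + inner g h"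
    unfolding inner_h2_suminf suminf_add[OF summable_inner_h2 summable_inner_h2]
    by (simp add: h2_coeff_plus algebra_simps)
  show "inner (r *\<^sub>R f) g = r * inner f g"
    unfolding inner_h2_suminf suminf_mult[OF summable_inner_h2, symmetric]
    by (simp add: scaleR_h2_def algebra_simps)
  show "0 \<le> inner f f"
    unfolding inner_h2_self by (intro suminf_nonneg summable_h2_coeff) auto
  show "inner f f = 0 \<longleftrightarrow> f = 0"
    unfolding inner_h2_self suminf_eq_zero_iff[OF summable_h2_coeff zero_le_power2]
    by (auto intro!: h2_eqI simp: h2_coeff_zero)
  show "norm f = sqrt (inner f f)"
    unfolding inner_h2_self norm_h2_def ..
qed

end

global_interpretation h2: vector_space h2_scaleC
  by unfold_locales (auto intro!: h2_eqI simp: h2_coeff_plus algebra_simps)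


section \<open>Compact operators and Schatten classes\<close>

definition bounded_operator_h2 :: "(h2 \<Rightarrow> h2) \<Rightarrow> bool" where
  "bounded_operator_h2 T \<longleftrightarrow>
     bounded_linear T \<and> (\<forall>c f. T (h2_scaleC c f) = h2_scaleC c (T f))"

definition compact_operator_h2 :: "(h2 \<Rightarrow> h2) \<Rightarrow> bool" where
  "compact_operator_h2 T \<longleftrightarrow>
     bounded_operator_h2 T \<and> compact (closure (T ` cball 0 1))"

text \<open>
  The adjoint with respect to the complex inner product; it exists and is unique for every
  bounded operator.
\<close>

definition h2_adjoint :: "(h2 \<Rightarrow> h2) \<Rightarrow> h2 \<Rightarrow> h2" where
  "h2_adjoint T = (THE S. \<forall>f g. h2_cinner (T f) g = h2_cinner f (S g))"

text \<open>
  The singular values of a compact \<open>T\<close> are the square roots of the eigenvalues of \<open>T\<^sup>* T\<close>,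
  in decreasing order and repeated according to (complex) multiplicity. The sequence is padded by
  zeros if \<open>T\<close> has finite rank. Since \<open>s\<close> tends to \<open>0\<close>, the sets \<open>{n. s n = \<sigma>}\<close> are finite, and so
  are, for compact \<open>T\<close>, the dimensions of the eigenspaces.
\<close>

definition singular_value_seq :: "(h2 \<Rightarrow> h2) \<Rightarrow> (nat \<Rightarrow> real) \<Rightarrow> bool" where
  "singular_value_seq T s \<longleftrightarrow>
     decseq s \<and> (\<forall>n. 0 \<le> s n) \<and> s \<longlonglongrightarrow> 0 \<and>
     (\<forall>\<sigma>>0. card {n. s n = \<sigma>} =
        h2.dim {f. h2_adjoint T (T f) = h2_scaleC (of_real (\<sigma>\<^sup>2)) f})"

definition schatten_class :: "real \<Rightarrow> (h2 \<Rightarrow> h2) set" where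
  "schatten_class p =
     {T. compact_operator_h2 T \<and> (\<exists>s. singular_value_seq T s \<and> summable (\<lambda>n. s n powr p))}"


section \<open>Symbols and composition operators\<close>

text \<open>
  A symbol is a holomorphic function on \<open>right_half_plane 0\<close> which is the sum of a
  Dirichlet series in some half-plane, i.e. where the series converges; the series is not
  required to converge in all of \<open>right_half_plane 0\<close>.
\<close>

definition symbol_class_G0 :: "(complex \<Rightarrow> complex) set" where
  "symbol_class_G0 =
     {\<phi>. \<phi> holomorphic_on right_half_plane 0 \<and>
         (\<exists>c. \<exists>\<sigma>\<ge>0. \<forall>s\<in>right_half_plane \<sigma>. dirichlet_term c s sums \<phi> s) \<and>
         \<phi> ` right_half_plane 0 \<subseteq> right_half_plane (1/2)}"

text \<open>
  The image of \<open>f\<close> under the composition operator is the element whose Dirichlet series represents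
  \<open>f \<circ> \<phi>\<close>. The two functions are compared on \<open>right_half_plane (1/2)\<close>, where the Dirichlet series of
  every element converges; this determines the coefficients.
\<close>

definition composition_operator :: "(complex \<Rightarrow> complex) \<Rightarrow> h2 \<Rightarrow> h2" where
  "composition_operator \<phi> f =
     (THE g. \<forall>s\<in>right_half_plane (1/2). h2_eval g s = h2_eval f (\<phi> s))"

end

theory Submission
  imports Defs "HOL-Complex_Analysis.Conformal_Mappings"
begin

text \<open>
  Both claims hold because \<open>C\<^sub>\<phi>\<close> is a Hilbert-Schmidt operator. Such an operator is compact, its
  singular values are square summable, and \<open>\<alpha> \<le> 2\<close> together with \<open>p > 1 / (\<alpha> - 1)\<close> gives \<open>2 p > 2\<close>.

  The reason is a computation of the Hilbert-Schmidt norm. The operator sends the basis vector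
  \<open>n powr - s\<close> to \<open>n powr - \<phi> s\<close>, and, formally, the square of the norm of a Dirichlet series is the mean of
  \<open>\<bar>f\<bar>\<^sup>2\<close> along the line \<open>Re s = 0\<close>. Summed over \<open>n\<close>, the squared norms of the images are therefore
  the mean of \<open>\<zeta> (2 Re \<phi>) \<le> 1 + 1 / (2 Re \<phi> - 1)\<close>. In the sector, \<open>\<bar>\<phi> - 1/2\<bar> \<le> K Re (\<phi> - 1/2)\<close>
  with \<open>K = 1 / cos (\<pi> / (2 \<alpha>))\<close>, so that this is at most \<open>1 + K\<^sup>2 / 2 * Re u\<close> for the holomorphic
  function \<open>u = 1 / (\<phi> - 1/2)\<close>. By Cauchy's theorem the mean of \<open>u\<close> is the same on every vertical line,
  and far to the right \<open>u\<close> is bounded, because \<open>\<phi>\<close> tends to its constant coefficient, whose real part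
  exceeds \<open>1/2\<close> (\<open>constant_coefficient_gt\<close>).

  This becomes rigorous without boundary values by working on the lines \<open>Re s = \<sigma>\<close> with \<open>\<sigma> > 0\<close> and
  with \<open>1 / (\<phi> - 1/2 + \<epsilon>)\<close>, which is bounded, in place of \<open>u\<close>. The mean of a bounded holomorphic
  function over a segment of length \<open>2 T\<close> changes by \<open>O(1 / T)\<close> when the line is moved
  (\<open>line_mean_shift\<close>). In place of Parseval's identity, Bessel's inequality for finitely many
  coefficients suffices (\<open>bessel_line_mean\<close>); at the end \<open>\<epsilon>\<close> and \<open>\<sigma>\<close> tend to \<open>0\<close>
  (\<open>composition_matrix_bound\<close>). That \<open>n powr - \<phi> s\<close> is a Dirichlet series in the first place is
  \<open>exp_dirichlet_series\<close>.

  On the side of operators, \<open>C\<^sub>\<phi>\<close> becomes an infinite matrix with square summable entries. Its image of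
  the unit ball lies in a Hilbert cube, hence compactness. The singular values are obtained without
  the spectral theorem: orthonormal eigenvectors of \<open>T\<^sup>* T\<close> for the eigenvalues \<open>\<sigma>\<^sup>2\<close> satisfy
  \<open>\<parallel>T v\<parallel> = \<sigma>\<close>, and the sum of \<open>\<parallel>T v\<parallel>\<^sup>2\<close> over an orthonormal family is at most the squared
  Hilbert-Schmidt norm. This bounds the multiplicities of the singular values, and
  \<open>decreasing_rearrangement\<close> turns any multiplicities bounded in this way into a square summable
  decreasing sequence.
\<close>

section \<open>Mean values along vertical lines\<close>

lemma right_half_plane_iff [simp]: "s \<in> right_half_plane \<theta> \<longleftrightarrow> \<theta> < Re s"
  by (simp add: right_half_plane_def)

lemma open_right_half_plane: "open (right_half_plane \<theta>)"
  unfolding right_half_plane_def by (rule open_halfspace_Re_gt)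

lemma convex_right_half_plane: "convex (right_half_plane \<theta>)"
  unfolding right_half_plane_def by (rule convex_halfspace_Re_gt)

lemma norm_nat_powr: "norm (of_nat n powr s :: complex) = of_nat n powr Re s"
  by (simp add: norm_powr_real_powr)

definition line_mean :: "real \<Rightarrow> (real \<Rightarrow> complex) \<Rightarrow> complex" where
  "line_mean T g = integral {- T..T} g / of_real (2 * T)"

lemma continuous_on_vertical_line:
  assumes "F holomorphic_on right_half_plane \<theta>" "\<theta> < \<sigma>"
  shows "continuous_on A (\<lambda>t. F (Complex \<sigma> t))"
proof -
  have "continuous_on A (\<lambda>t. Complex \<sigma> t)"
    by (auto simp: Complex_eq intro!: continuous_intros)
  moreover have "continuous_on ((\<lambda>t. Complex \<sigma> t) ` A) F"
    by (rule continuous_on_subset[OF holomorphic_on_imp_continuous_on[OF assms(1)]])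
      (use assms(2) in auto)
  ultimately show ?thesis
    using continuous_on_compose2 by blast
qed

lemma line_mean_add:
  assumes "continuous_on UNIV f" "continuous_on UNIV g"
  shows "line_mean T (\<lambda>t. f t + g t) = line_mean T f + line_mean T g"
proof -
  have "f integrable_on {-T..T}" "g integrable_on {-T..T}"
    using assms by (auto intro!: integrable_continuous_real intro: continuous_on_subset)
  then show ?thesis
    by (simp add: line_mean_def integral_add add_divide_distrib)
qed

lemma line_mean_cmult: "line_mean T (\<lambda>t. c * f t) = c * line_mean T f"
  by (simp add: line_mean_def)

lemma line_mean_sum:
  assumes "finite A" "\<And>i. i \<in> A \<Longrightarrow> continuous_on UNIV (f i)"
  shows "line_mean T (\<lambda>t. \<Sum>i\<in>A. f i t) = (\<Sum>i\<in>A. line_mean T (f i))"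
  using assms
proof (induction A rule: finite_induct)
  case empty
  then show ?case by (simp add: line_mean_def)
next
  case (insert i A)
  then show ?case by (simp add: line_mean_add continuous_on_sum)
qed

lemma norm_line_mean_le:
  assumes "T > 0" "continuous_on UNIV f" "\<And>t. norm (f t) \<le> B"
  shows "norm (line_mean T f) \<le> B"
proof -
  have "norm (integral {-T..T} f) \<le> B * (T - (-T))"
    by (rule integral_bound) (use assms in \<open>auto intro: continuous_on_subset\<close>)
  then show ?thesis
    using assms(1) by (simp add: line_mean_def norm_divide divide_simps)
qed

lemma Re_line_mean_mono:
  assumes "T > 0" "continuous_on UNIV f" "continuous_on UNIV g" "\<And>t. Re (f t) \<le> Re (g t)"
  shows "Re (line_mean T f) \<le> Re (line_mean T g)"
proof -
  have i: "f integrable_on {-T..T}" "g integrable_on {-T..T}"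
    using assms by (auto intro!: integrable_continuous_real intro: continuous_on_subset)
  have j: "(\<lambda>t. Re (f t)) integrable_on {-T..T}" "(\<lambda>t. Re (g t)) integrable_on {-T..T}"
    using assms by (auto intro!: integrable_continuous_real continuous_intros intro: continuous_on_subset)
  have "Re (integral {-T..T} f) = integral {-T..T} (\<lambda>t. Re (f t))"
       "Re (integral {-T..T} g) = integral {-T..T} (\<lambda>t. Re (g t))"
    using integral_linear[OF i(1) bounded_linear_Re] integral_linear[OF i(2) bounded_linear_Re]
    by (simp_all add: o_def)
  moreover have "integral {-T..T} (\<lambda>t. Re (f t)) \<le> integral {-T..T} (\<lambda>t. Re (g t))"
    by (rule integral_le) (use assms j in auto)
  ultimately show ?thesis
    using assms(1) unfolding line_mean_def Re_divide_of_real by (simp add: divide_right_mono)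
qed

lemma line_mean_const: "T > 0 \<Longrightarrow> line_mean T (\<lambda>t. c) = c"
  by (simp add: line_mean_def scaleR_conv_of_real)

text \<open>
  These characters are pairwise orthogonal for the mean value, which is what makes mean values
  extract Dirichlet coefficients.
\<close>

lemma line_mean_character:
  assumes "\<omega> \<noteq> 0"
  shows "((\<lambda>T. line_mean T (\<lambda>t. exp (\<i> * of_real \<omega> * of_real t))) \<longlongrightarrow> 0) at_top"
proof (rule Lim_null_comparison)
  show "((\<lambda>T. inverse \<bar>\<omega>\<bar> * inverse T) \<longlongrightarrow> 0) at_top"
    by (intro tendsto_mult_right_zero tendsto_inverse_0_at_top filterlim_ident)
  show "\<forall>\<^sub>F T in at_top. norm (line_mean T (\<lambda>t. exp (\<i> * of_real \<omega> * of_real t)))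
      \<le> inverse \<bar>\<omega>\<bar> * inverse T"
  proof (rule eventually_at_top_linorderI[of 1])
    fix T :: real assume T: "1 \<le> T"
    let ?c = "\<i> * of_real \<omega> :: complex"
    have "((\<lambda>t. exp (?c * of_real t)) has_integral
        exp (?c * of_real T) / ?c - exp (?c * of_real (-T)) / ?c) {-T..T}"
    proof (rule fundamental_theorem_of_calculus)
      show "-T \<le> T" using T by simp
      fix t assume "t \<in> {-T..T}"
      have "((\<lambda>z. exp (?c * z) / ?c) has_field_derivative exp (?c * of_real t)) (at (of_real t))"
        using assms by (auto intro!: derivative_eq_intros)
      from has_vector_derivative_real_field[OF this]
      show "((\<lambda>x. exp (?c * complex_of_real x) / ?c) has_vector_derivative
         exp (?c * complex_of_real t)) (at t within {- T..T})"
        by (simp add: o_def)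
    qed
    then have "integral {-T..T} (\<lambda>t. exp (?c * of_real t)) =
        exp (?c * of_real T) / ?c - exp (?c * of_real (-T)) / ?c"
      by (rule integral_unique)
    also have "norm \<dots> \<le> 1 / \<bar>\<omega>\<bar> + 1 / \<bar>\<omega>\<bar>"
      by (rule norm_triangle_le_diff) (simp add: norm_divide norm_mult)
    finally show "norm (line_mean T (\<lambda>t. exp (?c * of_real t))) \<le> inverse \<bar>\<omega>\<bar> * inverse T"
      using T by (simp add: line_mean_def norm_divide field_simps)
  qed
qed

text \<open>
  The two integrals are differences of a primitive of \<open>F\<close> at the corners of a rectangle, so they differ
  by the increments of the primitive along the two horizontal edges. These increments are bounded
  independently of \<open>T\<close>, while the mean divides by \<open>2 T\<close>.
\<close>

lemma line_mean_shift:
  assumes hol: "F holomorphic_on right_half_plane \<theta>" and "\<theta> < \<sigma>" "\<sigma> \<le> \<sigma>'" "T > 0"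
    and B: "\<And>s. \<sigma> \<le> Re s \<Longrightarrow> Re s \<le> \<sigma>' \<Longrightarrow> norm (F s) \<le> B"
  shows "norm (line_mean T (\<lambda>t. F (Complex \<sigma> t)) - line_mean T (\<lambda>t. F (Complex \<sigma>' t)))
    \<le> B * (\<sigma>' - \<sigma>) / T"
proof -
  obtain H where "\<And>x. x \<in> right_half_plane \<theta> \<Longrightarrow>
      (H has_field_derivative F x) (at x within right_half_plane \<theta>)"
    using holomorphic_convex_primitive'[OF convex_right_half_plane open_right_half_plane hol] by blast
  then have H: "(H has_field_derivative F x) (at x)" if "\<theta> < Re x" for x
    using that at_within_open[OF _ open_right_half_plane] by (metis right_half_plane_iff)
  have line: "integral {-T..T} (\<lambda>t. F (Complex \<rho> t)) = (H (Complex \<rho> T) - H (Complex \<rho> (-T))) / \<i>"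
    if "\<rho> > \<theta>" for \<rho>
  proof -
    have "((\<lambda>t. F (Complex \<rho> t)) has_integral H (Complex \<rho> T) / \<i> - H (Complex \<rho> (-T)) / \<i>) {-T..T}"
    proof (rule fundamental_theorem_of_calculus)
      show "-T \<le> T" using assms by simp
      fix t assume "t \<in> {-T..T}"
      have "((\<lambda>z. H (of_real \<rho> + \<i> * z)) has_field_derivative F (of_real \<rho> + \<i> * of_real t) * \<i>)
          (at (of_real t))"
        by (rule DERIV_chain2[OF H]) (use that in \<open>auto intro!: derivative_eq_intros\<close>)
      from DERIV_cdivide[OF this, of \<i>]
      have "((\<lambda>z. H (of_real \<rho> + \<i> * z) / \<i>) has_field_derivative F (of_real \<rho> + \<i> * of_real t))
          (at (of_real t))"
        unfolding nonzero_mult_div_cancel_right[OF complex_i_not_zero] .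
      from has_vector_derivative_real_field[OF this]
      show "((\<lambda>t. H (Complex \<rho> t) / \<i>) has_vector_derivative F (Complex \<rho> t)) (at t within {-T..T})"
        by (simp add: o_def Complex_eq)
    qed
    then show ?thesis by (simp add: integral_unique algebra_simps)
  qed
  have edge: "norm (H (Complex \<sigma> t) - H (Complex \<sigma>' t)) \<le> B * (\<sigma>' - \<sigma>)" for t
  proof -
    let ?S = "{s. \<sigma> \<le> Re s} \<inter> {s. Re s \<le> \<sigma>'}"
    have "norm (H (Complex \<sigma> t) - H (Complex \<sigma>' t)) \<le> B * norm (Complex \<sigma> t - Complex \<sigma>' t)"
    proof (rule field_differentiable_bound[where S = ?S and f' = F])
      show "convex ?S"
        by (intro convex_Int convex_halfspace_Re_ge convex_halfspace_Re_le)
      show "(H has_field_derivative F z) (at z within ?S)" if "z \<in> ?S" for z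
        using H[of z] that \<open>\<theta> < \<sigma>\<close> by (auto intro: has_field_derivative_at_within)
    qed (use B \<open>\<sigma> \<le> \<sigma>'\<close> in auto)
    also have "norm (Complex \<sigma> t - Complex \<sigma>' t) = \<sigma>' - \<sigma>"
      using \<open>\<sigma> \<le> \<sigma>'\<close> by (simp add: cmod_def)
    finally show ?thesis .
  qed
  have "line_mean T (\<lambda>t. F (Complex \<sigma> t)) - line_mean T (\<lambda>t. F (Complex \<sigma>' t))
     = ((H (Complex \<sigma> T) - H (Complex \<sigma>' T)) - (H (Complex \<sigma> (-T)) - H (Complex \<sigma>' (-T)))) / (\<i> * of_real (2 * T))"
    using assms by (simp add: line_mean_def line field_simps)
  also have "norm \<dots> \<le> (B * (\<sigma>' - \<sigma>) + B * (\<sigma>' - \<sigma>)) / (2 * T)"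
    using norm_triangle_le_diff[OF add_mono[OF edge[of T] edge[of "-T"]]] \<open>T > 0\<close>
    by (simp add: norm_divide norm_mult field_simps)
  finally show ?thesis by simp
qed

section \<open>Coefficients of a Dirichlet series as mean values\<close>

definition abs_convergent_at :: "real \<Rightarrow> (nat \<Rightarrow> complex) \<Rightarrow> bool" where
  "abs_convergent_at \<kappa> b \<longleftrightarrow> summable (\<lambda>m. norm (b m) * of_nat m powr - \<kappa>)"

lemma norm_dirichlet_term: "norm (dirichlet_term b s m) = norm (b m) * of_nat m powr - Re s"
  by (simp add: dirichlet_term_def norm_mult norm_nat_powr)

lemma nat_powr_antimono: "\<kappa> \<le> \<rho> \<Longrightarrow> real m powr - \<rho> \<le> real m powr - \<kappa>"
  by (cases "m = 0") (auto intro!: powr_mono)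

lemma abs_convergent_at_mono:
  assumes "abs_convergent_at \<kappa> b" "\<kappa> \<le> \<rho>"
  shows "abs_convergent_at \<rho> b"
  using assms(1) unfolding abs_convergent_at_def
  by (rule summable_comparison_test') (use assms(2) in \<open>auto intro!: mult_left_mono nat_powr_antimono\<close>)

text \<open>
  The bound does not depend on \<open>Im s\<close>. This uniformity along vertical lines allows mean values to be
  computed from partial sums.
\<close>

lemma dirichlet_tail:
  assumes "abs_convergent_at \<kappa> b" "\<And>s. \<kappa> \<le> Re s \<Longrightarrow> dirichlet_term b s sums F s" "\<kappa> \<le> Re s"
  shows "norm (F s - (\<Sum>m<J. dirichlet_term b s m)) \<le> (\<Sum>m. norm (b (m + J)) * of_nat (m + J) powr - \<kappa>)"
proof -
  have "(\<lambda>m. dirichlet_term b s (m + J)) sums (F s - (\<Sum>m<J. dirichlet_term b s m))"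
    using assms sums_split_initial_segment by blast
  moreover have "norm (dirichlet_term b s (m + J)) \<le> norm (b (m + J)) * of_nat (m + J) powr - \<kappa>" for m
    unfolding norm_dirichlet_term using assms(3) by (intro mult_left_mono nat_powr_antimono) auto
  moreover have "summable (\<lambda>m. norm (b (m + J)) * of_nat (m + J) powr - \<kappa>)"
    using assms(1) unfolding abs_convergent_at_def by (subst summable_iff_shift)
  ultimately show ?thesis
    by (metis (no_types, lifting) sums_unique norm_suminf_le)
qed

lemma line_mean_monomial:
  assumes "k > 0"
  shows "((\<lambda>T. line_mean T (\<lambda>t. of_nat m powr - Complex \<sigma> t * of_nat k powr Complex \<sigma> t)) \<longlongrightarrow>
    (if m = k then 1 else 0)) at_top"
proof (cases "m = 0")
  case True
  then show ?thesis using assms by (simp add: line_mean_def)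
next
  case False
  define \<omega> where "\<omega> = ln (real k) - ln (real m)"
  have eq: "of_nat m powr - Complex \<sigma> t * of_nat k powr Complex \<sigma> t =
      exp (of_real (\<sigma> * \<omega>)) * exp (\<i> * of_real \<omega> * of_real t)" for t
  proof -
    have "of_nat m powr - Complex \<sigma> t * of_nat k powr Complex \<sigma> t =
        exp (- Complex \<sigma> t * of_real (ln (real m))) * exp (Complex \<sigma> t * of_real (ln (real k)))"
      using False assms by (simp add: powr_def Ln_of_nat)
    also have "\<dots> = exp (- Complex \<sigma> t * of_real (ln (real m)) + Complex \<sigma> t * of_real (ln (real k)))"
      by (rule exp_add[symmetric])
    also have "\<dots> = exp (of_real (\<sigma> * \<omega>) + \<i> * of_real \<omega> * of_real t)"
      by (rule arg_cong[of _ _ exp]) (simp add: \<omega>_def Complex_eq algebra_simps)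
    finally show ?thesis by (simp add: exp_add)
  qed
  show ?thesis
  proof (cases "m = k")
    case True
    then have "\<omega> = 0" by (simp add: \<omega>_def)
    then have "\<forall>\<^sub>F T in at_top. line_mean T (\<lambda>t. of_nat m powr - Complex \<sigma> t * of_nat k powr Complex \<sigma> t) = 1"
      unfolding eq by (intro eventually_at_top_linorderI[of 1]) (simp add: line_mean_const)
    then show ?thesis using True by (simp add: tendsto_eventually)
  next
    case ne: False
    then have "\<omega> \<noteq> 0" using False assms by (simp add: \<omega>_def)
    from tendsto_mult_right_zero[OF line_mean_character[OF this]]
    show ?thesis unfolding eq line_mean_cmult using ne by simp
  qed
qed

lemma continuous_on_nat_powr_line [continuous_intros]:
  "continuous_on A (\<lambda>t. of_nat m powr - Complex \<sigma> t)" "continuous_on A (\<lambda>t. of_nat m powr Complex \<sigma> t)"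
  by (cases "m = 0"; auto simp: powr_def Complex_eq intro!: continuous_intros)+

text \<open>
  For a partial sum this is the orthogonality of characters; the tail is uniformly small on the line,
  so its mean is small for every \<open>T\<close>.
\<close>

lemma line_mean_coefficient:
  assumes abs: "abs_convergent_at \<kappa> b" and sums: "\<And>s. \<kappa> \<le> Re s \<Longrightarrow> dirichlet_term b s sums F s"
    and cont: "continuous_on UNIV (\<lambda>t. F (Complex \<kappa> t))" and k: "k > 0"
  shows "((\<lambda>T. line_mean T (\<lambda>t. F (Complex \<kappa> t) * of_nat k powr Complex \<kappa> t)) \<longlongrightarrow> b k) at_top"
proof (rule tendstoI)
  fix e :: real assume e: "e > 0"
  define tail where "tail J = (\<Sum>m. norm (b (m + J)) * of_nat (m + J) powr - \<kappa>)" for J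
  have "tail \<longlonglongrightarrow> 0"
    unfolding tail_def using abs unfolding abs_convergent_at_def by (rule suminf_exist_split2)
  then have "(\<lambda>J. tail J * of_nat k powr \<kappa>) \<longlonglongrightarrow> 0"
    by (rule tendsto_mult_left_zero)
  then have "\<forall>\<^sub>F J in sequentially. tail J * of_nat k powr \<kappa> < e / 2 \<and> k < J"
    using e by (intro eventually_conj eventually_gt_at_top order_tendstoD) auto
  then obtain J where J: "tail J * of_nat k powr \<kappa> < e / 2" "k < J"
    using eventually_happens'[OF sequentially_bot] by blast
  let ?K = "\<lambda>t. of_nat k powr Complex \<kappa> t :: complex"
  let ?P = "\<lambda>t. \<Sum>m<J. dirichlet_term b (Complex \<kappa> t) m"
  have "line_mean T (\<lambda>t. ?P t * ?K t) = (\<Sum>m<J. b m * line_mean T (\<lambda>t. of_nat m powr - Complex \<kappa> t * ?K t))" for T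
    unfolding sum_distrib_right dirichlet_term_def
    by (subst line_mean_sum) (auto intro!: continuous_intros simp flip: line_mean_cmult simp: mult.assoc)
  moreover have "((\<lambda>T. (\<Sum>m<J. b m * line_mean T (\<lambda>t. of_nat m powr - Complex \<kappa> t * ?K t))) \<longlongrightarrow>
      (\<Sum>m<J. b m * (if m = k then 1 else 0))) at_top"
    by (intro tendsto_intros line_mean_monomial k)
  moreover have "(\<Sum>m<J. b m * (if m = k then 1 else 0)) = b k"
    using J(2) by (simp add: if_distrib cong: if_cong)
  ultimately have "((\<lambda>T. line_mean T (\<lambda>t. ?P t * ?K t)) \<longlongrightarrow> b k) at_top"
    by simp
  then have "\<forall>\<^sub>F T in at_top. dist (line_mean T (\<lambda>t. ?P t * ?K t)) (b k) < e / 2"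
    using e by (intro tendstoD) auto
  then show "\<forall>\<^sub>F T in at_top. dist (line_mean T (\<lambda>t. F (Complex \<kappa> t) * ?K t)) (b k) < e"
    using eventually_gt_at_top[of 0]
  proof eventually_elim
    case (elim T)
    have c: "continuous_on UNIV ?P"
      by (auto simp: dirichlet_term_def intro!: continuous_intros)
    have "line_mean T (\<lambda>t. F (Complex \<kappa> t) * ?K t) =
      line_mean T (\<lambda>t. ?P t * ?K t + (F (Complex \<kappa> t) - ?P t) * ?K t)"
      by (simp add: algebra_simps)
    also have "\<dots> = line_mean T (\<lambda>t. ?P t * ?K t) + line_mean T (\<lambda>t. (F (Complex \<kappa> t) - ?P t) * ?K t)"
      by (rule line_mean_add) (auto intro!: continuous_intros cont c)
    finally have "dist (line_mean T (\<lambda>t. F (Complex \<kappa> t) * ?K t)) (line_mean T (\<lambda>t. ?P t * ?K t))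
       = norm (line_mean T (\<lambda>t. (F (Complex \<kappa> t) - ?P t) * ?K t))"
      by (simp add: dist_norm)
    also have "\<dots> \<le> tail J * of_nat k powr \<kappa>"
    proof (rule norm_line_mean_le)
      fix t
      show "norm ((F (Complex \<kappa> t) - ?P t) * ?K t) \<le> tail J * of_nat k powr \<kappa>"
        using dirichlet_tail[OF abs sums, of "Complex \<kappa> t" J]
        unfolding tail_def norm_mult norm_nat_powr by (simp add: mult_right_mono)
    qed (use elim in \<open>auto intro!: continuous_intros cont c\<close>)
    finally show ?case
      using J(1) elim(1) dist_triangle[of "line_mean T (\<lambda>t. F (Complex \<kappa> t) * ?K t)" "b k" "line_mean T (\<lambda>t. ?P t * ?K t)"]
      by linarith
  qed
qed

text \<open>
  On a vertical line the conjugate of a Dirichlet monomial is, up to a constant, a holomorphic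
  exponential. Inner products with Dirichlet polynomials thus become means of holomorphic functions.
\<close>

lemma cnj_nat_powr_line:
  assumes "m > 0"
  shows "cnj (of_nat m powr - Complex \<sigma> t) = of_real (real m powr (- 2 * \<sigma>)) * of_nat m powr Complex \<sigma> t"
proof -
  have "cnj (of_nat m powr - Complex \<sigma> t) = exp (- Complex \<sigma> (-t) * of_real (ln (real m)))"
  proof -
    have "cnj (Complex \<sigma> t) = Complex \<sigma> (-t)"
      by (simp add: complex_eq_iff)
    then show ?thesis using assms by (simp add: powr_def exp_cnj)
  qed
  also have "\<dots> = exp (of_real (- 2 * \<sigma> * ln (real m)) + Complex \<sigma> t * of_real (ln (real m)))"
    by (rule arg_cong[of _ _ exp]) (simp add: complex_eq_iff algebra_simps)
  also have "\<dots> = exp (of_real (- 2 * \<sigma> * ln (real m))) * exp (Complex \<sigma> t * of_real (ln (real m)))"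
    by (rule exp_add)
  also have "exp (of_real (- 2 * \<sigma> * ln (real m))) = complex_of_real (real m powr (- 2 * \<sigma>))"
    using assms unfolding exp_of_real by (simp add: powr_def)
  also have "exp (Complex \<sigma> t * of_real (ln (real m))) = of_nat m powr Complex \<sigma> t"
    using assms by (simp add: powr_def)
  finally show ?thesis .
qed

lemma holomorphic_nat_powr [holomorphic_intros]:
  assumes "f holomorphic_on S"
  shows "(\<lambda>s. of_nat k powr f s) holomorphic_on S"
  by (cases "k = 0") (auto simp: powr_def intro!: holomorphic_intros assms)

text \<open>
  The Dirichlet series need not converge on the line \<open>Re s = \<sigma>\<close>. The formula is carried there from the
  region of absolute convergence by \<open>line_mean_shift\<close>, applied to \<open>F s * k powr s\<close>.
\<close>

lemma line_mean_coefficient_bounded: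
  assumes hol: "F holomorphic_on right_half_plane 0" and B: "\<And>s. 0 < Re s \<Longrightarrow> norm (F s) \<le> B"
    and abs: "abs_convergent_at \<kappa> b" and sums: "\<And>s. \<kappa> \<le> Re s \<Longrightarrow> dirichlet_term b s sums F s"
    and \<sigma>: "\<sigma> > 0" and k: "k > 0"
  shows "((\<lambda>T. line_mean T (\<lambda>t. F (Complex \<sigma> t) * of_nat k powr Complex \<sigma> t)) \<longlongrightarrow> b k) at_top"
proof -
  \<comment> \<open>The shift starts from a line on which the series converges absolutely.\<close>
  define \<kappa>' where "\<kappa>' = max \<kappa> \<sigma>"
  let ?G = "\<lambda>s. F s * of_nat k powr s"
  have far: "((\<lambda>T. line_mean T (\<lambda>t. ?G (Complex \<kappa>' t))) \<longlongrightarrow> b k) at_top"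
    by (rule line_mean_coefficient)
      (use abs sums \<sigma> k in \<open>auto simp: \<kappa>'_def intro: abs_convergent_at_mono continuous_on_vertical_line[OF hol]\<close>)
  have "((\<lambda>T. line_mean T (\<lambda>t. ?G (Complex \<sigma> t)) - line_mean T (\<lambda>t. ?G (Complex \<kappa>' t))) \<longlongrightarrow> 0) at_top"
  proof (rule Lim_null_comparison)
    show "((\<lambda>T. B * real k powr \<kappa>' * (\<kappa>' - \<sigma>) * inverse T) \<longlongrightarrow> 0) at_top"
      by (intro tendsto_mult_right_zero tendsto_inverse_0_at_top filterlim_ident)
    show "\<forall>\<^sub>F T in at_top. norm (line_mean T (\<lambda>t. ?G (Complex \<sigma> t)) - line_mean T (\<lambda>t. ?G (Complex \<kappa>' t)))
        \<le> B * real k powr \<kappa>' * (\<kappa>' - \<sigma>) * inverse T"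
      using eventually_gt_at_top[of 0]
    proof eventually_elim
      case (elim T)
      show ?case
        unfolding divide_inverse[symmetric]
      proof (rule line_mean_shift[where F = ?G])
        show "?G holomorphic_on right_half_plane 0"
          by (intro holomorphic_intros hol)
        show "norm (?G s) \<le> B * real k powr \<kappa>'" if "\<sigma> \<le> Re s" "Re s \<le> \<kappa>'" for s
          unfolding norm_mult norm_nat_powr
        proof (rule mult_mono)
          show "norm (F s) \<le> B" using B[of s] that \<sigma> by simp
          show "real k powr Re s \<le> real k powr \<kappa>'" using that k by (intro powr_mono) auto
          show "0 \<le> B" using order_trans[OF norm_ge_zero B[of 1]] by simp
        qed auto
      qed (use elim \<sigma> in \<open>auto simp: \<kappa>'_def\<close>)
    qed
  qed
  from tendsto_add[OF this far] show ?thesis by simp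
qed

text \<open>
  Let \<open>P\<close> be the Dirichlet polynomial with the coefficients \<open>b 1, \<dots>, b M\<close>. Then \<open>\<bar>F - P\<bar>\<^sup>2 \<ge> 0\<close> gives
  \<open>\<bar>F\<bar>\<^sup>2 \<ge> 2 Re (F cnj P) - \<bar>P\<bar>\<^sup>2\<close>, and \<open>Q T\<close> is the mean of the right-hand side; by the coefficient
  formulas for \<open>F\<close> and for \<open>P\<close> both products have the mean \<open>\<Sum> \<bar>b m\<bar>\<^sup>2 m powr (- 2 \<sigma>)\<close>. The function
  \<open>Q\<close> avoids the question whether the mean of \<open>\<bar>F\<bar>\<^sup>2\<close> converges.
\<close>

lemma bessel_line_mean:
  assumes hol: "F holomorphic_on right_half_plane 0" and B: "\<And>s. 0 < Re s \<Longrightarrow> norm (F s) \<le> B"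
    and abs: "abs_convergent_at \<kappa> b" and sums: "\<And>s. \<kappa> \<le> Re s \<Longrightarrow> dirichlet_term b s sums F s"
    and \<sigma>: "\<sigma> > 0"
  obtains Q where "(Q \<longlongrightarrow> (\<Sum>m=1..M. (cmod (b m))\<^sup>2 * real m powr (- 2 * \<sigma>))) at_top"
    "\<And>T. T > 0 \<Longrightarrow> Q T \<le> Re (line_mean T (\<lambda>t. of_real ((cmod (F (Complex \<sigma> t)))\<^sup>2)))"
proof -
  define P where "P t = (\<Sum>m=1..M. b m * of_nat m powr - Complex \<sigma> t)" for t
  define w where "w m = cnj (b m) * of_real (real m powr (- 2 * \<sigma>))" for m
  have contF: "continuous_on UNIV (\<lambda>t. F (Complex \<sigma> t))"
    by (rule continuous_on_vertical_line[OF hol \<sigma>])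
  have contP: "continuous_on UNIV P"
    unfolding P_def by (intro continuous_intros)
  have cnjP: "cnj (P t) = (\<Sum>m=1..M. w m * of_nat m powr Complex \<sigma> t)" for t
    unfolding P_def w_def by (simp add: cnj_nat_powr_line mult.assoc)
  have pair: "((\<lambda>T. line_mean T (\<lambda>t. G t * cnj (P t))) \<longlongrightarrow> (\<Sum>m=1..M. w m * b m)) at_top"
    if "continuous_on UNIV G"
      and lim: "\<And>m. m \<in> {1..M} \<Longrightarrow> ((\<lambda>T. line_mean T (\<lambda>t. G t * of_nat m powr Complex \<sigma> t)) \<longlongrightarrow> b m) at_top"
    for G
  proof -
    have "line_mean T (\<lambda>t. G t * cnj (P t)) =
        (\<Sum>m=1..M. w m * line_mean T (\<lambda>t. G t * of_nat m powr Complex \<sigma> t))" for T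
    proof -
      have "line_mean T (\<lambda>t. G t * cnj (P t)) =
          line_mean T (\<lambda>t. \<Sum>m=1..M. w m * (G t * of_nat m powr Complex \<sigma> t))"
        unfolding cnjP sum_distrib_left by (simp add: algebra_simps)
      also have "\<dots> = (\<Sum>m=1..M. line_mean T (\<lambda>t. w m * (G t * of_nat m powr Complex \<sigma> t)))"
        by (rule line_mean_sum) (auto intro!: continuous_intros that(1))
      finally show ?thesis by (simp only: line_mean_cmult)
    qed
    then show ?thesis
      by (auto intro!: tendsto_intros lim)
  qed
  have limF: "((\<lambda>T. line_mean T (\<lambda>t. F (Complex \<sigma> t) * cnj (P t))) \<longlongrightarrow> (\<Sum>m=1..M. w m * b m)) at_top"
    by (intro pair contF line_mean_coefficient_bounded[OF hol B abs sums \<sigma>]) auto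
  have limP: "((\<lambda>T. line_mean T (\<lambda>t. P t * cnj (P t))) \<longlongrightarrow> (\<Sum>m=1..M. w m * b m)) at_top"
  proof (rule pair[OF contP])
    fix k assume k: "k \<in> {1..M}"
    have "line_mean T (\<lambda>t. P t * of_nat k powr Complex \<sigma> t) =
        (\<Sum>m=1..M. b m * line_mean T (\<lambda>t. of_nat m powr - Complex \<sigma> t * of_nat k powr Complex \<sigma> t))" for T
    proof -
      have "line_mean T (\<lambda>t. P t * of_nat k powr Complex \<sigma> t) =
          line_mean T (\<lambda>t. \<Sum>m=1..M. b m * (of_nat m powr - Complex \<sigma> t * of_nat k powr Complex \<sigma> t))"
        unfolding P_def sum_distrib_right by (simp only: mult.assoc)
      also have "\<dots> = (\<Sum>m=1..M. line_mean T (\<lambda>t. b m * (of_nat m powr - Complex \<sigma> t * of_nat k powr Complex \<sigma> t)))"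
        by (rule line_mean_sum) (auto intro!: continuous_intros)
      finally show ?thesis by (simp only: line_mean_cmult)
    qed
    moreover have "((\<lambda>T. (\<Sum>m=1..M. b m * line_mean T (\<lambda>t. of_nat m powr - Complex \<sigma> t * of_nat k powr Complex \<sigma> t)))
        \<longlongrightarrow> (\<Sum>m=1..M. b m * (if m = k then 1 else 0))) at_top"
      using k by (intro tendsto_intros line_mean_monomial) auto
    moreover have "(\<Sum>m=1..M. b m * (if m = k then 1 else 0)) = b k"
      using k by (simp add: if_distrib cong: if_cong)
    ultimately show "((\<lambda>T. line_mean T (\<lambda>t. P t * of_nat k powr Complex \<sigma> t)) \<longlongrightarrow> b k) at_top"
      by simp
  qed
  \<comment> \<open>Both means in \<open>Q T\<close> have the same limit \<open>S\<close>, so \<open>Q\<close> tends to \<open>2 S - S\<close>.\<close>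
  define Q where "Q T = Re (2 * line_mean T (\<lambda>t. F (Complex \<sigma> t) * cnj (P t)) - line_mean T (\<lambda>t. P t * cnj (P t)))" for T
  have "(Q \<longlongrightarrow> Re (2 * (\<Sum>m=1..M. w m * b m) - (\<Sum>m=1..M. w m * b m))) at_top"
    unfolding Q_def by (intro tendsto_intros limF limP)
  also have "Re (2 * (\<Sum>m=1..M. w m * b m) - (\<Sum>m=1..M. w m * b m)) = Re (\<Sum>m=1..M. w m * b m)"
    by simp
  also have "\<dots> = (\<Sum>m=1..M. (cmod (b m))\<^sup>2 * real m powr (- 2 * \<sigma>))"
    unfolding Re_sum w_def
    by (rule sum.cong[OF refl], unfold cmod_power2) (simp add: power2_eq_square algebra_simps)
  finally have "(Q \<longlongrightarrow> (\<Sum>m=1..M. (cmod (b m))\<^sup>2 * real m powr (- 2 * \<sigma>))) at_top" .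
  moreover have "Q T \<le> Re (line_mean T (\<lambda>t. of_real ((cmod (F (Complex \<sigma> t)))\<^sup>2)))" if "T > 0" for T
  proof -
    have "Q T = Re (line_mean T (\<lambda>t. 2 * (F (Complex \<sigma> t) * cnj (P t)) + (-1) * (P t * cnj (P t))))"
      unfolding Q_def
      by (subst line_mean_add, (intro continuous_intros contF contP)+, simp only: line_mean_cmult, simp)
    also have "\<dots> \<le> Re (line_mean T (\<lambda>t. of_real ((cmod (F (Complex \<sigma> t)))\<^sup>2)))"
    proof (rule Re_line_mean_mono[OF that])
      fix t
      have "0 \<le> (cmod (F (Complex \<sigma> t) - P t))\<^sup>2" by simp
      then show "Re (2 * (F (Complex \<sigma> t) * cnj (P t)) + (-1) * (P t * cnj (P t)))
          \<le> Re (of_real ((cmod (F (Complex \<sigma> t)))\<^sup>2))"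
        unfolding cmod_power2 by (simp add: power2_eq_square algebra_simps)
    qed (intro continuous_intros contF contP)+
    finally show ?thesis .
  qed
  ultimately show ?thesis using that by blast
qed

lemma dirichlet_coefficients_unique:
  assumes "abs_convergent_at \<kappa> b" "\<And>s. \<kappa> \<le> Re s \<Longrightarrow> dirichlet_term b s sums F s"
    and "abs_convergent_at \<kappa> b'" "\<And>s. \<kappa> \<le> Re s \<Longrightarrow> dirichlet_term b' s sums F s"
    and "continuous_on UNIV (\<lambda>t. F (Complex \<kappa> t))" "k > 0"
  shows "b k = b' k"
  using line_mean_coefficient[OF assms(1,2,5,6)] line_mean_coefficient[OF assms(3,4,5,6)]
  by (rule tendsto_unique[OF trivial_limit_at_top_linorder])

section \<open>Exponentials of Dirichlet series\<close>

lemma has_sum_congI: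
  assumes "(f has_sum S) A" "\<And>x. x \<in> A \<Longrightarrow> f x = g x" "S = S'"
  shows "(g has_sum S') A"
  using assms has_sum_cong by metis

lemma has_sum_prod_list_fixed_length:
  fixes x :: "'b \<Rightarrow> 'a :: {real_normed_field, banach}"
  assumes "(\<lambda>k. norm (x k)) summable_on UNIV"
  shows "(\<lambda>ks. norm (prod_list (map x ks))) summable_on {ks. length ks = j} \<and>
    ((\<lambda>ks. prod_list (map x ks)) has_sum (infsum x UNIV) ^ j) {ks. length ks = j}"
proof (induction j)
  case 0
  then show ?case by (auto intro: has_sum_finiteI)
next
  case (Suc j)
  let ?L = "{ks :: 'b list. length ks = j}" and ?p = "\<lambda>ks. prod_list (map x ks)"
  have bij: "bij_betw (\<lambda>(k, ks). k # ks) (UNIV \<times> ?L) {ks. length ks = Suc j}"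
    by (auto simp: bij_betw_def inj_on_def length_Suc_conv)
  have inner: "(\<lambda>ks. norm (x k * ?p ks)) summable_on ?L" for k
    using Suc.IH by (auto simp: norm_mult intro: summable_on_cmult_right)
  have "infsum (\<lambda>ks. norm (x k * ?p ks)) ?L = norm (x k) * infsum (\<lambda>ks. norm (?p ks)) ?L" for k
    using Suc.IH by (simp add: norm_mult infsum_cmult_right)
  moreover have "(\<lambda>k. norm (norm (x k) * infsum (\<lambda>ks. norm (?p ks)) ?L)) summable_on UNIV"
    using assms by (simp add: abs_mult infsum_nonneg summable_on_cmult_left)
  ultimately have abs: "(\<lambda>i. norm (case i of (k, ks) \<Rightarrow> x k * ?p ks)) summable_on UNIV \<times> ?L"
    by (subst Infinite_Sum.abs_summable_on_Sigma_iff) (auto simp: inner)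
  have "((\<lambda>(k, ks). x k * ?p ks) has_sum (infsum x UNIV * infsum x UNIV ^ j)) (UNIV \<times> ?L)"
  proof (rule has_sum_SigmaI)
    show "((\<lambda>ks. case (k, ks) of (k, ks) \<Rightarrow> x k * ?p ks) has_sum x k * infsum x UNIV ^ j) ?L" for k
      using has_sum_cmult_right[OF conjunct2[OF Suc.IH]] by simp
    show "((\<lambda>k. x k * infsum x UNIV ^ j) has_sum infsum x UNIV * infsum x UNIV ^ j) UNIV"
      using Infinite_Sum.abs_summable_summable[OF assms] by (intro has_sum_cmult_left has_sum_infsum)
    show "(\<lambda>(k, ks). x k * ?p ks) summable_on UNIV \<times> ?L"
      using abs by (rule Infinite_Sum.abs_summable_summable)
  qed
  moreover have "(\<lambda>(k, ks). x k * ?p ks) = (\<lambda>i. ?p ((\<lambda>(k, ks). k # ks) i))"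
    by (auto simp: fun_eq_iff)
  ultimately show ?case
    using abs has_sum_reindex_bij_betw[OF bij, of ?p]
      summable_on_reindex_bij_betw[OF bij, of "\<lambda>ks. norm (?p ks)"] by simp
qed

text \<open>
  Expanding \<open>(\<Sum>k. x k) ^ j\<close> gives a sum over lists of length \<open>j\<close>, so the exponential series becomes one
  absolutely convergent sum over all lists.
\<close>

lemma has_sum_exp_lists:
  fixes x :: "'b \<Rightarrow> complex" and z :: complex
  assumes "(\<lambda>k. norm (x k)) summable_on UNIV"
  defines "w \<equiv> \<lambda>ks. z ^ length ks / fact (length ks) * prod_list (map x ks)"
  shows "(\<lambda>ks. norm (w ks)) summable_on UNIV" and "(w has_sum exp (z * infsum x UNIV)) UNIV"
proof -
  let ?L = "\<lambda>j. {ks :: 'b list. length ks = j}"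
  have bij: "bij_betw snd (SIGMA j:UNIV. ?L j) UNIV"
    by (auto simp: bij_betw_def inj_on_def image_iff)
  have sumL: "((\<lambda>ks. w ks) has_sum (z * infsum x UNIV) ^ j / fact j) (?L j)" for j
  proof -
    have "((\<lambda>ks. z ^ j / fact j * prod_list (map x ks)) has_sum z ^ j / fact j * infsum x UNIV ^ j) (?L j)"
      using has_sum_prod_list_fixed_length[OF assms(1)] by (intro has_sum_cmult_right) auto
    then show ?thesis
      unfolding w_def by (rule has_sum_congI) (auto simp: power_mult_distrib)
  qed
  let ?r = "norm z * infsum (\<lambda>k. norm (x k)) UNIV"
  have normL: "((\<lambda>ks. norm (w ks)) has_sum ?r ^ j / fact j) (?L j)" for j
  proof -
    have n: "norm (prod_list (map x ks)) = prod_list (map (\<lambda>k. norm (x k)) ks)" for ks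
      by (induction ks) (auto simp: norm_mult)
    have "((\<lambda>ks. norm (z ^ j / fact j) * prod_list (map (\<lambda>k. norm (x k)) ks)) has_sum
        norm (z ^ j / fact j) * infsum (\<lambda>k. norm (x k)) UNIV ^ j) (?L j)"
      using has_sum_prod_list_fixed_length[of "\<lambda>k. norm (x k)"] assms(1)
      by (intro has_sum_cmult_right) auto
    then show ?thesis
      unfolding w_def
      by (rule has_sum_congI)
        (auto simp: power_mult_distrib norm_mult norm_divide norm_power n)
  qed
  have "summable (\<lambda>j. norm (?r ^ j / fact j))"
    using summable_norm_exp[of ?r] by (simp add: field_simps)
  then have "(\<lambda>j. ?r ^ j / fact j) summable_on UNIV"
    by (rule norm_summable_imp_summable_on)
  then have "(\<lambda>i. norm (w (snd i))) summable_on (SIGMA j:UNIV. ?L j)"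
    by (intro summable_on_SigmaI[where g = "\<lambda>j. ?r ^ j / fact j"]) (auto simp: normL)
  then show abs: "(\<lambda>ks. norm (w ks)) summable_on UNIV"
    using summable_on_reindex_bij_betw[OF bij, of "\<lambda>ks. norm (w ks)"] by simp
  have "w summable_on UNIV"
    using abs by (rule Infinite_Sum.abs_summable_summable)
  then have "((\<lambda>i. w (snd i)) has_sum infsum w UNIV) (SIGMA j:UNIV. ?L j)"
    by (subst has_sum_reindex_bij_betw[OF bij]) simp
  then have "((\<lambda>j. (z * infsum x UNIV) ^ j / fact j) has_sum infsum w UNIV) UNIV"
    by (rule has_sum_SigmaD) (auto simp: sumL)
  then have "(\<lambda>j. (z * infsum x UNIV) ^ j / fact j) sums infsum w UNIV"
    by (rule has_sum_imp_sums)
  moreover have "(\<lambda>j. (z * infsum x UNIV) ^ j / fact j) sums exp (z * infsum x UNIV)"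
    using exp_converges[of "z * infsum x UNIV"] by (simp add: scaleR_conv_of_real field_simps)
  ultimately have "infsum w UNIV = exp (z * infsum x UNIV)"
    by (rule sums_unique2)
  then show "(w has_sum exp (z * infsum x UNIV)) UNIV"
    using \<open>w summable_on UNIV\<close> by (metis has_sum_infsum)
qed

text \<open>
  An absolutely convergent sum of multiples of \<open>(N i) powr - s\<close>, over any index type, is a Dirichlet
  series: terms with the same base are collected. Terms with \<open>N i = 0\<close> vanish, and they are
  discarded because their coefficients need not be summable.
\<close>

lemma dirichlet_regroup:
  fixes w :: "'i \<Rightarrow> complex" and N :: "'i \<Rightarrow> nat"
  assumes abs: "(\<lambda>i. norm (w i) * real (N i) powr - \<kappa>) summable_on UNIV"
  obtains b where "abs_convergent_at \<kappa> b"
    "\<And>s S. \<kappa> \<le> Re s \<Longrightarrow> ((\<lambda>i. w i * of_nat (N i) powr - s) has_sum S) UNIV \<Longrightarrow> dirichlet_term b s sums S"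
proof -
  let ?fib = "\<lambda>m. {i. N i = m}"
  have bij: "bij_betw snd (SIGMA m:UNIV. ?fib m) UNIV"
    by (auto simp: bij_betw_def inj_on_def image_iff)
  define b where "b m = (if m = 0 then 0 else infsum w (?fib m))" for m
  have fib_abs: "(\<lambda>i. norm (w i)) summable_on ?fib m" if "m > 0" for m
  proof -
    have "(\<lambda>i. norm (w i) * real (N i) powr - \<kappa>) summable_on ?fib m"
      using abs by (rule summable_on_subset) auto
    then have "(\<lambda>i. norm (w i) * real m powr - \<kappa>) summable_on ?fib m"
      by (rule summable_on_cong[THEN iffD1, rotated]) auto
    then show ?thesis using that by (subst (asm) summable_on_cmult_left') auto
  qed
  have fib: "((\<lambda>i. w i * of_nat (N i) powr - s) has_sum dirichlet_term b s m) (?fib m)" for s m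
  proof (cases "m = 0")
    case True
    have "((\<lambda>i. 0 :: complex) has_sum 0) (?fib m)" by simp
    then have "((\<lambda>i. w i * of_nat (N i) powr - s) has_sum 0) (?fib m)"
      by (rule has_sum_congI) (auto simp: True)
    then show ?thesis by (simp add: True dirichlet_term_def)
  next
    case False
    have "((\<lambda>i. w i * of_nat m powr - s) has_sum infsum w (?fib m) * of_nat m powr - s) (?fib m)"
      using Infinite_Sum.abs_summable_summable[OF fib_abs] False
      by (intro has_sum_cmult_left has_sum_infsum) auto
    then have "((\<lambda>i. w i * of_nat (N i) powr - s) has_sum infsum w (?fib m) * of_nat m powr - s) (?fib m)"
      by (rule has_sum_congI) auto
    then show ?thesis using False by (simp add: b_def dirichlet_term_def)
  qed
  show ?thesis
  proof
    fix s S assume "\<kappa> \<le> Re s" and S: "((\<lambda>i. w i * of_nat (N i) powr - s) has_sum S) UNIV"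
    from S have "((\<lambda>p. w (snd p) * of_nat (N (snd p)) powr - s) has_sum S) (SIGMA m:UNIV. ?fib m)"
      by (subst has_sum_reindex_bij_betw[OF bij])
    then have "(dirichlet_term b s has_sum S) UNIV"
      by (rule has_sum_SigmaD) (auto simp: fib)
    then show "dirichlet_term b s sums S"
      by (rule has_sum_imp_sums)
  next
    let ?h = "\<lambda>i. norm (w i) * real (N i) powr - \<kappa>"
    have hfib: "(?h has_sum infsum ?h (?fib m)) (?fib m)" for m
      using summable_on_subset[OF abs] by (intro has_sum_infsum) auto
    have "(?h has_sum infsum ?h UNIV) UNIV"
      using abs by simp
    then have "((\<lambda>p. ?h (snd p)) has_sum infsum ?h UNIV) (SIGMA m:UNIV. ?fib m)"
      by (subst has_sum_reindex_bij_betw[OF bij])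
    then have "((\<lambda>m. infsum ?h (?fib m)) has_sum infsum ?h UNIV) UNIV"
      by (rule has_sum_SigmaD) (use hfib in auto)
    then have "summable (\<lambda>m. infsum ?h (?fib m))"
      using has_sum_imp_sums sums_summable by blast
    then have "summable (\<lambda>m. norm (dirichlet_term b (of_real \<kappa>) m))"
    proof (rule summable_comparison_test')
      show "norm (norm (dirichlet_term b (of_real \<kappa>) m)) \<le> infsum ?h (?fib m)" for m
        using norm_infsum_le[OF fib[of "of_real \<kappa>" m] hfib[of m]]
        by (simp add: norm_mult norm_nat_powr)
    qed
    then show "abs_convergent_at \<kappa> b"
      by (simp add: abs_convergent_at_def norm_dirichlet_term)
  qed
qed

lemma nat_powr_mult: "of_nat (a * b) powr (z :: complex) = of_nat a powr z * of_nat b powr z"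
proof (cases "a = 0 \<or> b = 0")
  case False
  then have "exp (z * of_real (ln (real (a * b)))) = exp (z * of_real (ln (real a)) + z * of_real (ln (real b)))"
    by (simp add: ln_mult distrib_left)
  then show ?thesis using False by (simp add: powr_def exp_add Ln_of_nat del: of_nat_mult)
qed auto

text \<open>
  The product of the monomials \<open>k powr - s\<close> over a list is the monomial of the product of the list, so
  the sum over lists regroups into a Dirichlet series. With \<open>z = - ln n\<close> this applies to
  \<open>n powr - F s\<close>.
\<close>

lemma exp_dirichlet_series:
  assumes abs: "abs_convergent_at \<kappa> c" and sums: "\<And>s. \<kappa> \<le> Re s \<Longrightarrow> dirichlet_term c s sums F s"
  obtains b where "abs_convergent_at \<kappa> b" "\<And>s. \<kappa> \<le> Re s \<Longrightarrow> dirichlet_term b s sums exp (z * F s)"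
proof -
  define w where "w ks = z ^ length ks / fact (length ks) * prod_list (map c ks)" for ks
  have prod: "prod_list (map (dirichlet_term c s) ks) = prod_list (map c ks) * of_nat (prod_list ks) powr - s" for s ks
    by (induction ks) (auto simp: dirichlet_term_def nat_powr_mult simp del: of_nat_mult)
  have abs_at: "(\<lambda>m. norm (dirichlet_term c s m)) summable_on UNIV" if "\<kappa> \<le> Re s" for s
    using abs_convergent_at_mono[OF abs that]
    by (simp add: summable_on_UNIV_nonneg_real_iff abs_convergent_at_def norm_dirichlet_term)
  have "(\<lambda>ks. norm (z ^ length ks / fact (length ks) * prod_list (map (dirichlet_term c (of_real \<kappa>)) ks))) summable_on UNIV"
    by (intro has_sum_exp_lists abs_at) simp
  then have "(\<lambda>ks. norm (w ks) * real (prod_list ks) powr - \<kappa>) summable_on UNIV"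
    unfolding prod w_def norm_mult norm_nat_powr by (simp add: mult.assoc)
  then obtain b where b: "abs_convergent_at \<kappa> b"
    "\<And>s S. \<kappa> \<le> Re s \<Longrightarrow> ((\<lambda>ks. w ks * of_nat (prod_list ks) powr - s) has_sum S) UNIV \<Longrightarrow> dirichlet_term b s sums S"
    by (rule dirichlet_regroup) blast
  have "dirichlet_term b s sums exp (z * F s)" if s: "\<kappa> \<le> Re s" for s
  proof (rule b(2)[OF s])
    have "(dirichlet_term c s has_sum F s) UNIV"
      using abs_at[OF s] sums[OF s]
      by (intro norm_summable_imp_has_sum) (auto simp: summable_on_UNIV_nonneg_real_iff)
    then have "infsum (dirichlet_term c s) UNIV = F s"
      by (rule infsumI)
    then show "((\<lambda>ks. w ks * of_nat (prod_list ks) powr - s) has_sum exp (z * F s)) UNIV"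
      using has_sum_exp_lists(2)[OF abs_at[OF s], of z] unfolding w_def prod by (simp add: mult.assoc)
  qed
  with b(1) show ?thesis using that by blast
qed

section \<open>The mean value estimate in a sector\<close>

text \<open>
  The terms are bounded at \<open>\<sigma> + 1\<close>, and two further units on the real axis supply the convergent factor
  \<open>m powr - 2\<close>.
\<close>

lemma abs_convergent_at_of_convergent:
  assumes "\<And>s. \<sigma> < Re s \<Longrightarrow> summable (dirichlet_term c s)"
  shows "abs_convergent_at (\<sigma> + 3) c"
proof -
  have "dirichlet_term c (of_real (\<sigma> + 1)) \<longlonglongrightarrow> 0"
    by (rule summable_LIMSEQ_zero) (use assms in auto)
  then have "Bseq (dirichlet_term c (of_real (\<sigma> + 1)))"
    using convergentI convergent_imp_Bseq by blast
  then obtain B where "\<And>m. norm (dirichlet_term c (of_real (\<sigma> + 1)) m) \<le> B"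
    unfolding Bseq_def by blast
  then have B: "norm (c m) * real m powr - (\<sigma> + 1) \<le> B" for m
    by (simp add: norm_dirichlet_term)
  have "norm (c m) * real m powr - (\<sigma> + 3) \<le> B * real m powr - 2" for m
  proof -
    have "real m powr - (\<sigma> + 3) = real m powr - (\<sigma> + 1) * real m powr - 2"
      unfolding powr_add[symmetric] by (rule arg_cong[of _ _ "\<lambda>x. real m powr x"]) simp
    then show ?thesis
      using mult_right_mono[OF B[of m], of "real m powr - 2"] by (simp add: mult.assoc)
  qed
  then have "norm (norm (c m) * real m powr - (\<sigma> + 3)) \<le> B * real m powr - 2" for m
    by (metis abs_of_nonneg mult_nonneg_nonneg norm_ge_zero powr_ge_zero real_norm_def)
  moreover have "summable (\<lambda>m. B * real m powr - 2)"
    by (intro summable_mult) (simp add: summable_real_powr_iff)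
  ultimately show ?thesis
    unfolding abs_convergent_at_def by (rule summable_comparison_test'[rotated])
qed

text \<open>
  The quantitative form of the fact that the first terms of a Dirichlet series dominate as \<open>Re s\<close> tends
  to infinity.
\<close>

lemma dirichlet_tail_decay:
  assumes abs: "abs_convergent_at \<kappa> c" and sums: "\<And>s. \<kappa> \<le> Re s \<Longrightarrow> dirichlet_term c s sums F s"
    and "\<kappa> \<le> Re s" and J: "J > 0"
  shows "norm (F s - (\<Sum>m<J. dirichlet_term c s m)) \<le>
    real J powr (\<kappa> - Re s) * (\<Sum>m. norm (c m) * real m powr - \<kappa>)"
proof -
  let ?a = "\<lambda>m. norm (c m) * real m powr - \<kappa>" and ?r = "real J powr (\<kappa> - Re s)"
  have a: "summable ?a" using abs by (simp add: abs_convergent_at_def)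
  have s: "abs_convergent_at (Re s) c" using abs_convergent_at_mono[OF abs assms(3)] .
  have "norm (F s - (\<Sum>m<J. dirichlet_term c s m)) \<le> (\<Sum>m. norm (c (m + J)) * real (m + J) powr - Re s)"
    by (rule dirichlet_tail[OF s]) (use sums assms(3) in auto)
  also have "\<dots> \<le> (\<Sum>m. ?r * ?a (m + J))"
  proof (rule suminf_le)
    show "norm (c (m + J)) * real (m + J) powr - Re s \<le> ?r * ?a (m + J)" for m
    proof -
      have "real (m + J) powr - Re s = real (m + J) powr (\<kappa> - Re s) * real (m + J) powr - \<kappa>"
        by (simp flip: powr_add)
      also have "\<dots> \<le> ?r * real (m + J) powr - \<kappa>"
        using J assms(3) by (intro mult_right_mono powr_mono2') auto
      finally show ?thesis
        using mult_left_mono[of _ _ "norm (c (m + J))"] by (metis mult.left_commute norm_ge_zero)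
    qed
    show "summable (\<lambda>m. norm (c (m + J)) * real (m + J) powr - Re s)"
      using s unfolding abs_convergent_at_def by (rule summable_ignore_initial_segment)
    show "summable (\<lambda>m. ?r * ?a (m + J))"
      by (intro summable_mult summable_ignore_initial_segment[OF a])
  qed
  also have "\<dots> = ?r * (\<Sum>m. ?a (m + J))"
    by (rule suminf_mult) (rule summable_ignore_initial_segment[OF a])
  also have "\<dots> \<le> ?r * (\<Sum>m. ?a m)"
    using suminf_split_initial_segment[OF a, of J] sum_nonneg[of "{..<J}" ?a]
    by (intro mult_left_mono) auto
  finally show ?thesis .
qed

lemma powr_tendsto_0_at_top:
  assumes "0 < q" "q < (1 :: real)"
  shows "((\<lambda>x. q powr x) \<longlongrightarrow> 0) at_top"
proof -
  have "filterlim (\<lambda>x. ln q * x) at_bot at_top"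
    using assms by (intro filterlim_tendsto_neg_mult_at_bot[OF tendsto_const _ filterlim_ident]) auto
  from filterlim_compose[OF exp_at_bot this] show ?thesis
    using assms by (simp add: powr_def mult.commute)
qed

text \<open>
  The strict inequality survives the limit \<open>Re s \<rightarrow> \<infinity>\<close>: if \<open>c k\<close> is the first nonzero coefficient with
  \<open>k \<ge> 2\<close>, then \<open>F s\<close> is \<open>c 1 + c k * k powr - s\<close> up to a smaller error, and \<open>Im s\<close> can be chosen so
  that the second term is negative. At such a point \<open>\<theta> < Re (F s) < Re (c 1)\<close>.
\<close>

lemma constant_coefficient_gt:
  assumes abs: "abs_convergent_at \<kappa> c" and sums: "\<And>s. \<kappa> \<le> Re s \<Longrightarrow> dirichlet_term c s sums F s"
    and gt: "\<And>s. \<kappa> \<le> Re s \<Longrightarrow> \<theta> < Re (F s)"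
  shows "\<theta> < Re (c 1)"
proof -
  let ?A = "\<Sum>m. norm (c m) * real m powr - \<kappa>"
  show ?thesis
  proof (cases "\<exists>k\<ge>2. c k \<noteq> 0")
    case False
    have "dirichlet_term c (of_real \<kappa>) sums (\<Sum>m\<in>{1}. dirichlet_term c (of_real \<kappa>) m)"
    proof (rule sums_finite)
      fix m :: nat assume "m \<notin> {1}"
      then have "m = 0 \<or> 2 \<le> m" by auto
      then show "dirichlet_term c (of_real \<kappa>) m = 0"
        using False by (auto simp: dirichlet_term_def)
    qed auto
    then have "F (of_real \<kappa>) = c 1"
      using sums_unique2[OF sums[of "of_real \<kappa>"]] by (simp add: dirichlet_term_def)
    then show ?thesis using gt[of "of_real \<kappa>"] by simp
  next
    case True
    define k where "k = (LEAST k. 2 \<le> k \<and> c k \<noteq> 0)"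
    have k: "2 \<le> k" "c k \<noteq> 0" and least: "\<And>m. 2 \<le> m \<Longrightarrow> m < k \<Longrightarrow> c m = 0"
      using LeastI_ex[of "\<lambda>k. 2 \<le> k \<and> c k \<noteq> 0"] not_less_Least[of _ "\<lambda>k. 2 \<le> k \<and> c k \<noteq> 0"] True
      unfolding k_def by blast+
    define q where "q = real k / real (Suc k)"
    have q: "0 < q" "q < 1" using k by (auto simp: q_def)
    have "((\<lambda>\<rho>. q powr \<rho> * (real (Suc k) powr \<kappa> * ?A)) \<longlongrightarrow> 0) at_top"
      using q by (intro tendsto_mult_left_zero powr_tendsto_0_at_top)
    then have "\<forall>\<^sub>F \<rho> in at_top. q powr \<rho> * (real (Suc k) powr \<kappa> * ?A) < norm (c k) \<and> \<kappa> \<le> \<rho>"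
      using k by (intro eventually_conj eventually_ge_at_top order_tendstoD) auto
    then obtain \<rho> where \<rho>: "q powr \<rho> * (real (Suc k) powr \<kappa> * ?A) < norm (c k)" "\<kappa> \<le> \<rho>"
      using eventually_happens'[OF trivial_limit_at_top_linorder] by blast
    have lt: "real (Suc k) powr (\<kappa> - \<rho>) * ?A < norm (c k) * real k powr - \<rho>"
    proof -
      have "real (Suc k) powr (\<kappa> - \<rho>) * ?A = q powr \<rho> * (real (Suc k) powr \<kappa> * ?A) * real k powr - \<rho>"
        using k by (simp add: q_def powr_divide powr_diff powr_minus field_simps)
      also have "\<dots> < norm (c k) * real k powr - \<rho>"
        using k by (intro mult_strict_right_mono \<rho>) auto
      finally show ?thesis .
    qed
    \<comment> \<open>This height turns \<open>c k * k powr - s\<close> into a negative real number.\<close>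
    define t where "t = Arg (- c k) / ln (real k)"
    let ?s = "Complex \<rho> t"
    have "Complex \<rho> t * of_real (ln (real k)) = of_real (\<rho> * ln (real k)) + \<i> * of_real (Arg (- c k))"
      using k by (simp add: t_def complex_eq_iff)
    then have "of_nat k powr - ?s = exp (- (of_real (\<rho> * ln (real k)) + \<i> * of_real (Arg (- c k))))"
      using k by (simp add: powr_def)
    also have "\<dots> = of_real (real k powr - \<rho>) * exp (- (\<i> * of_real (Arg (- c k))))"
      using k by (simp add: powr_def exp_diff exp_of_real[symmetric] exp_minus field_simps)
    finally have pk: "of_nat k powr - ?s = of_real (real k powr - \<rho>) * exp (- (\<i> * of_real (Arg (- c k))))" .
    have ck: "c k = - of_real (norm (c k)) * exp (\<i> * of_real (Arg (- c k)))"
      using Arg_eq[of "- c k"] k by (simp add: minus_equation_iff)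
    have "dirichlet_term c ?s k = - of_real (norm (c k) * real k powr - \<rho>)"
      unfolding dirichlet_term_def pk by (subst ck) (simp add: exp_minus)
    moreover have "(\<Sum>m<Suc k. dirichlet_term c ?s m) = (\<Sum>m\<in>{1, k}. dirichlet_term c ?s m)"
    proof (rule sum.mono_neutral_right)
      show "\<forall>m\<in>{..<Suc k} - {1, k}. dirichlet_term c ?s m = 0"
      proof
        fix m assume "m \<in> {..<Suc k} - {1, k}"
        then have "m = 0 \<or> 2 \<le> m \<and> m < k" by auto
        then show "dirichlet_term c ?s m = 0" using least by (auto simp: dirichlet_term_def)
      qed
    qed (use k in auto)
    ultimately have sum: "(\<Sum>m<Suc k. dirichlet_term c ?s m) = c 1 - of_real (norm (c k) * real k powr - \<rho>)"
      using k by (simp add: dirichlet_term_def)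
    have "norm (F ?s - (c 1 - of_real (norm (c k) * real k powr - \<rho>))) \<le> real (Suc k) powr (\<kappa> - \<rho>) * ?A"
      using dirichlet_tail_decay[OF abs sums, of ?s "Suc k"] \<rho> unfolding sum by simp
    from order_trans[OF complex_Re_le_cmod this]
    have "Re (F ?s) \<le> Re (c 1) - norm (c k) * real k powr - \<rho> + real (Suc k) powr (\<kappa> - \<rho>) * ?A"
      by simp
    with lt gt[of ?s] \<rho> show ?thesis by simp
  qed
qed

lemma dirichlet_bounded_below_on_line:
  assumes abs: "abs_convergent_at \<kappa> c" and sums: "\<And>s. \<kappa> \<le> Re s \<Longrightarrow> dirichlet_term c s sums F s"
    and gt: "\<And>s. \<kappa> \<le> Re s \<Longrightarrow> \<theta> < Re (F s)"
  obtains \<rho> \<delta> where "\<kappa> \<le> \<rho>" "1 \<le> \<rho>" "0 < \<delta>" "\<And>s. Re s = \<rho> \<Longrightarrow> \<theta> + \<delta> \<le> Re (F s)"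
proof -
  let ?A = "\<Sum>m. norm (c m) * real m powr - \<kappa>"
  define \<delta> where "\<delta> = (Re (c 1) - \<theta>) / 2"
  have \<delta>: "\<delta> > 0" using constant_coefficient_gt[OF abs sums gt] by (simp add: \<delta>_def)
  have "((\<lambda>\<rho>. (1/2) powr \<rho> * (2 powr \<kappa> * ?A)) \<longlongrightarrow> 0) at_top"
    by (intro tendsto_mult_left_zero powr_tendsto_0_at_top) auto
  then have "\<forall>\<^sub>F \<rho> in at_top. (1/2) powr \<rho> * (2 powr \<kappa> * ?A) < \<delta> \<and> max \<kappa> 1 \<le> \<rho>"
    using \<delta> by (intro eventually_conj eventually_ge_at_top order_tendstoD) auto
  then obtain \<rho> where \<rho>: "(1/2) powr \<rho> * (2 powr \<kappa> * ?A) < \<delta>" "max \<kappa> 1 \<le> \<rho>"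
    using eventually_happens'[OF trivial_limit_at_top_linorder] by blast
  show ?thesis
  proof
    fix s :: complex assume s: "Re s = \<rho>"
    have "(\<Sum>m<2. dirichlet_term c s m) = c 1"
      by (simp add: numeral_2_eq_2 dirichlet_term_def)
    then have "norm (F s - c 1) \<le> 2 powr (\<kappa> - \<rho>) * ?A"
      using dirichlet_tail_decay[OF abs sums, of s 2] s \<rho> by simp
    also have "\<dots> = (1/2) powr \<rho> * (2 powr \<kappa> * ?A)"
      by (simp add: powr_divide powr_diff)
    finally have "norm (F s - c 1) < \<delta>" using \<rho> by simp
    then show "\<theta> + \<delta> \<le> Re (F s)"
      using abs_Re_le_cmod[of "F s - c 1"] unfolding \<delta>_def minus_complex.sel by (simp add: field_simps)
  qed (use \<rho> \<delta> in auto)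
qed

text \<open>
  Comparison with the integral of \<open>x powr - a\<close>, in the form of a telescoping sum whose terms are
  estimated by the mean value theorem.
\<close>

lemma zeta_partial_sum_le:
  fixes a :: real
  assumes a: "a > 1"
  shows "(\<Sum>n=1..N. real n powr - a) \<le> 1 + 1 / (a - 1)"
proof -
  have step: "real (Suc n) powr - a \<le> (real n powr (1 - a) - real (Suc n) powr (1 - a)) / (a - 1)"
    if "n > 0" for n
  proof -
    have "\<exists>\<xi>::real. real n < \<xi> \<and> \<xi> < real (Suc n) \<and>
        real (Suc n) powr (1 - a) - real n powr (1 - a) = (real (Suc n) - real n) * ((1 - a) * \<xi> powr - a)"
    proof (rule MVT2)
      fix x :: real assume "real n \<le> x" "x \<le> real (Suc n)"
      then have "x > 0" using that by linarith
      then show "((\<lambda>x. x powr (1 - a)) has_real_derivative (1 - a) * x powr - a) (at x)"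
        by (auto intro!: derivative_eq_intros)
    qed simp
    then obtain \<xi> :: real where \<xi>: "real n < \<xi>" "\<xi> < real (Suc n)"
      "real n powr (1 - a) - real (Suc n) powr (1 - a) = (a - 1) * \<xi> powr - a"
      by (auto simp: algebra_simps)
    have "real (Suc n) powr - a \<le> \<xi> powr - a"
      using \<xi> a that by (intro powr_mono2') auto
    then show ?thesis using \<xi>(3) a by simp
  qed
  have "(\<Sum>n=1..Suc N. real n powr - a) \<le> 1 + (1 - real (Suc N) powr (1 - a)) / (a - 1)" for N
  proof (induction N)
    case (Suc N)
    have "(\<Sum>n=1..Suc (Suc N). real n powr - a) = (\<Sum>n=1..Suc N. real n powr - a) + real (Suc (Suc N)) powr - a"
      by simp
    also have "\<dots> \<le> 1 + (1 - real (Suc N) powr (1 - a)) / (a - 1) +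
        (real (Suc N) powr (1 - a) - real (Suc (Suc N)) powr (1 - a)) / (a - 1)"
      by (intro add_mono Suc.IH step) simp
    also have "\<dots> = 1 + (1 - real (Suc (Suc N)) powr (1 - a)) / (a - 1)"
      by (simp add: diff_divide_distrib)
    finally show ?case .
  qed simp
  moreover have "1 + (1 - real (Suc N) powr (1 - a)) / (a - 1) \<le> 1 + 1 / (a - 1)" for N
    using a by (intro add_left_mono divide_right_mono) auto
  ultimately have "(\<Sum>n=1..Suc N. real n powr - a) \<le> 1 + 1 / (a - 1)" for N
    using order_trans by blast
  then show ?thesis
    using a by (cases N) (auto simp: add_nonneg_nonneg)
qed

text \<open>
  Here the sector enters: \<open>Re (1 / w) = Re w / \<bar>w\<bar>\<^sup>2\<close>, so \<open>\<bar>w\<bar> \<le> K Re w\<close> turns the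
  bound \<open>1 / Re w\<close> into the real part of a holomorphic function of \<open>w\<close>, here
  \<open>w = v + \<epsilon>\<close>. Adding \<open>\<epsilon> \<ge> 0\<close> does not leave the sector.
\<close>

lemma weighted_sum_nat_powr_le:
  assumes v: "0 < Re v" "norm v \<le> K * Re v" and \<epsilon>: "0 \<le> \<epsilon>" "1 \<le> K"
  defines "u \<equiv> inverse (v + of_real \<epsilon>)"
  shows "(\<Sum>n=1..N. real n powr (- 2 * \<epsilon>) * (norm (of_nat n powr - (v + 1/2)))\<^sup>2) \<le> 1 + K\<^sup>2 / 2 * Re u"
proof -
  let ?x = "Re v + \<epsilon>"
  have x: "?x > 0" using v \<epsilon> by simp
  have "real n powr (- 2 * \<epsilon>) * (norm (of_nat n powr - (v + 1/2)))\<^sup>2 = real n powr - (1 + 2 * ?x)" for n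
    unfolding norm_nat_powr power2_eq_square powr_add[symmetric]
    by (rule arg_cong[of _ _ "\<lambda>x. real n powr x"]) simp
  then have "(\<Sum>n=1..N. real n powr (- 2 * \<epsilon>) * (norm (of_nat n powr - (v + 1/2)))\<^sup>2)
      = (\<Sum>n=1..N. real n powr - (1 + 2 * ?x))" by simp
  also have "\<dots> \<le> 1 + 1 / (1 + 2 * ?x - 1)"
    using x by (intro zeta_partial_sum_le) simp
  also have "\<dots> = 1 + 1 / 2 * (1 / ?x)"
    by simp
  also have "1 / ?x \<le> K\<^sup>2 * Re u"
  proof -
    have "norm (v + of_real \<epsilon>) \<le> norm v + \<epsilon>" using norm_triangle_ineq[of v "of_real \<epsilon>"] \<epsilon> by simp
    also have "\<dots> \<le> K * Re v + K * \<epsilon>" using v \<epsilon> by (intro add_mono mult_right_mono[of 1 K \<epsilon>, simplified]) auto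
    finally have "norm (v + of_real \<epsilon>) \<le> K * ?x" by (simp add: algebra_simps)
    then have "(norm (v + of_real \<epsilon>))\<^sup>2 \<le> (K * ?x)\<^sup>2" by (intro power_mono) auto
    moreover have "(norm (v + of_real \<epsilon>))\<^sup>2 > 0"
      using x by (auto simp: complex_eq_iff)
    moreover have "Re u = ?x / (norm (v + of_real \<epsilon>))\<^sup>2"
      unfolding u_def cmod_power2 by simp
    ultimately show ?thesis
      using x by (simp add: field_simps power2_eq_square)
  qed
  finally show ?thesis by simp
qed

text \<open>
  The bound for the squared Hilbert-Schmidt norm, for finite sections of the matrix. The constant
  depends only on \<open>K\<close> and on the lower bound \<open>\<delta>\<close> for \<open>Re \<phi> - 1/2\<close> on the line \<open>Re s = \<rho>\<close>, to which the
  mean of the regularised \<open>u\<close> is moved because \<open>\<bar>u\<bar> \<le> 1 / \<delta>\<close> there.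
\<close>

lemma composition_matrix_bound:
  fixes b :: "nat \<Rightarrow> nat \<Rightarrow> complex"
  assumes hol: "\<phi> holomorphic_on right_half_plane 0"
    and gt: "\<And>s. 0 < Re s \<Longrightarrow> 1/2 < Re (\<phi> s)"
    and sector: "\<And>s. 0 < Re s \<Longrightarrow> norm (\<phi> s - 1/2) \<le> K * Re (\<phi> s - 1/2)" and K: "1 \<le> K"
    and abs: "\<And>n. abs_convergent_at \<kappa> (b n)"
    and sums: "\<And>n s. n > 0 \<Longrightarrow> \<kappa> \<le> Re s \<Longrightarrow> dirichlet_term (b n) s sums of_nat n powr - \<phi> s"
    and \<rho>: "1 \<le> \<rho>" "0 < \<delta>" "\<And>s. Re s = \<rho> \<Longrightarrow> 1/2 + \<delta> \<le> Re (\<phi> s)"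
  shows "(\<Sum>n=1..N. \<Sum>m=1..M. (cmod (b n m))\<^sup>2) \<le> 1 + K\<^sup>2 / (2 * \<delta>)"
proof -
  have regularised: "(\<Sum>n=1..N. real n powr (- 2 * \<epsilon>) * (\<Sum>m=1..M. (cmod (b n m))\<^sup>2 * real m powr (- 2 * \<sigma>)))
      \<le> 1 + K\<^sup>2 / (2 * \<delta>)" if \<epsilon>: "0 < \<epsilon>" and \<sigma>: "0 < \<sigma>" "\<sigma> \<le> \<rho>" for \<epsilon> \<sigma>
  proof -
    let ?F = "\<lambda>n s. of_nat n powr - \<phi> s"
    define S where "S n = (\<Sum>m=1..M. (cmod (b n m))\<^sup>2 * real m powr (- 2 * \<sigma>))" for n
    define u where "u s = inverse (\<phi> s - 1/2 + of_real \<epsilon>)" for s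
    \<comment> \<open>Adding \<open>\<epsilon>\<close> keeps the denominator away from \<open>0\<close>, so \<open>u\<close> is bounded by \<open>1 / \<epsilon>\<close> on the whole half-plane.\<close>
    have re: "\<epsilon> \<le> Re (\<phi> s - 1/2 + of_real \<epsilon>)" if "0 < Re s" for s
      using gt[OF that] by simp
    have holu: "u holomorphic_on right_half_plane 0"
      unfolding u_def
    proof (intro holomorphic_intros hol)
      fix s assume "s \<in> right_half_plane 0"
      then have "0 < Re (\<phi> s - 1/2 + of_real \<epsilon>)" using re[of s] \<epsilon> by simp
      then show "\<phi> s - 1/2 + of_real \<epsilon> \<noteq> 0" by (metis less_irrefl zero_complex.sel(1))
    qed
    have normu: "norm (u s) \<le> 1 / d" if "0 < d" "d \<le> Re (\<phi> s - 1/2 + of_real \<epsilon>)" for s d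
    proof -
      have "d \<le> norm (\<phi> s - 1/2 + of_real \<epsilon>)"
        using that complex_Re_le_cmod order_trans by blast
      then show ?thesis using that(1) unfolding u_def norm_inverse by (simp add: divide_simps)
    qed
    have contu: "continuous_on UNIV (\<lambda>t. u (Complex x t))" if "0 < x" for x
      using continuous_on_vertical_line[OF holu that] .
    have "\<exists>Q. (Q \<longlongrightarrow> S n) at_top \<and>
        (\<forall>T>0. Q T \<le> Re (line_mean T (\<lambda>t. of_real ((cmod (?F n (Complex \<sigma> t)))\<^sup>2))))" if "n \<in> {1..N}" for n
    proof -
      have F1: "?F n holomorphic_on right_half_plane 0"
        by (intro holomorphic_intros hol)
      have F2: "norm (?F n s) \<le> 1" if "0 < Re s" for s
      proof -
        have "real n powr - Re (\<phi> s) \<le> real n powr 0"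
          using gt[OF that] \<open>n \<in> {1..N}\<close> by (intro powr_mono) auto
        then show ?thesis using \<open>n \<in> {1..N}\<close> by (simp add: norm_nat_powr)
      qed
      have F3: "dirichlet_term (b n) s sums ?F n s" if "\<kappa> \<le> Re s" for s
        using \<open>n \<in> {1..N}\<close> that sums by simp
      show ?thesis
        unfolding S_def using bessel_line_mean[where F = "?F n", OF F1 F2 abs F3 \<sigma>(1), of M] by blast
    qed
    then obtain Q where Qlim: "\<And>n. n \<in> {1..N} \<Longrightarrow> (Q n \<longlongrightarrow> S n) at_top"
      and Qle: "\<And>n T. n \<in> {1..N} \<Longrightarrow> T > 0 \<Longrightarrow>
        Q n T \<le> Re (line_mean T (\<lambda>t. of_real ((cmod (?F n (Complex \<sigma> t)))\<^sup>2)))"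
      by metis
    have le: "(\<Sum>n=1..N. real n powr (- 2 * \<epsilon>) * Q n T) \<le> 1 + K\<^sup>2 / 2 * (1 / \<delta> + (1 / \<epsilon> * (\<rho> - \<sigma>)) * inverse T)"
      if T: "T > 0" for T
    proof -
      have contF: "continuous_on UNIV (\<lambda>t. of_real ((cmod (?F n (Complex \<sigma> t)))\<^sup>2) :: complex)" for n
        by (intro continuous_intros continuous_on_vertical_line[where F = "?F n", OF _ \<sigma>(1)] holomorphic_intros hol)
      have "(\<Sum>n=1..N. real n powr (- 2 * \<epsilon>) * Q n T) \<le>
          (\<Sum>n=1..N. real n powr (- 2 * \<epsilon>) * Re (line_mean T (\<lambda>t. of_real ((cmod (?F n (Complex \<sigma> t)))\<^sup>2))))"
        using T by (intro sum_mono mult_left_mono Qle) auto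
      also have "\<dots> = Re (\<Sum>n=1..N. line_mean T (\<lambda>t. of_real (real n powr (- 2 * \<epsilon>)) * of_real ((cmod (?F n (Complex \<sigma> t)))\<^sup>2)))"
        unfolding line_mean_cmult Re_sum by simp
      also have "\<dots> = Re (line_mean T (\<lambda>t. \<Sum>n=1..N. of_real (real n powr (- 2 * \<epsilon>)) * of_real ((cmod (?F n (Complex \<sigma> t)))\<^sup>2)))"
        by (subst line_mean_sum) (auto intro!: continuous_on_mult continuous_on_const contF simp del: of_real_power)
      also have "\<dots> \<le> Re (line_mean T (\<lambda>t. 1 + of_real (K\<^sup>2 / 2) * u (Complex \<sigma> t)))"
      proof (rule Re_line_mean_mono[OF T])
        fix t
        have "(\<Sum>n=1..N. real n powr (- 2 * \<epsilon>) * (norm (of_nat n powr - (\<phi> (Complex \<sigma> t) - 1/2 + 1/2)))\<^sup>2)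
            \<le> 1 + K\<^sup>2 / 2 * Re (u (Complex \<sigma> t))"
          unfolding u_def
          by (rule weighted_sum_nat_powr_le) (use gt[of "Complex \<sigma> t"] sector[of "Complex \<sigma> t"] \<sigma> \<epsilon> K in auto)
        then show "Re (\<Sum>n=1..N. of_real (real n powr (- 2 * \<epsilon>)) * of_real ((cmod (?F n (Complex \<sigma> t)))\<^sup>2))
            \<le> Re (1 + of_real (K\<^sup>2 / 2) * u (Complex \<sigma> t))"
          by (simp flip: of_real_mult of_real_power of_real_sum)
      qed (intro continuous_on_sum continuous_on_add continuous_on_mult continuous_on_const contF contu \<sigma>)+
      also have "\<dots> = 1 + K\<^sup>2 / 2 * Re (line_mean T (\<lambda>t. u (Complex \<sigma> t)))"
      proof -
        have "continuous_on UNIV (\<lambda>t. of_real (K\<^sup>2 / 2) * u (Complex \<sigma> t))"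
          by (intro continuous_on_mult continuous_on_const contu \<sigma>)
        then show ?thesis
          using T by (subst line_mean_add) (simp_all only: line_mean_cmult line_mean_const
            continuous_on_const plus_complex.sel one_complex.sel Re_complex_of_real times_complex.sel Im_complex_of_real)
      qed
      also have "\<dots> \<le> 1 + K\<^sup>2 / 2 * (1 / \<delta> + (1 / \<epsilon> * (\<rho> - \<sigma>)) * inverse T)"
      proof -
        have "norm (line_mean T (\<lambda>t. u (Complex \<sigma> t)) - line_mean T (\<lambda>t. u (Complex \<rho> t))) \<le> 1 / \<epsilon> * (\<rho> - \<sigma>) / T"
          by (rule line_mean_shift[OF holu \<sigma> T]) (use normu[OF \<epsilon> re] \<sigma> in auto)
        moreover have "norm (line_mean T (\<lambda>t. u (Complex \<rho> t))) \<le> 1 / \<delta>"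
        proof (rule norm_line_mean_le[OF T contu])
          show "norm (u (Complex \<rho> t)) \<le> 1 / \<delta>" for t
            using \<rho>(3)[of "Complex \<rho> t"] \<epsilon> by (intro normu \<rho>(2)) auto
        qed (use \<rho>(1) in auto)
        ultimately have "norm (line_mean T (\<lambda>t. u (Complex \<sigma> t))) \<le> 1 / \<delta> + 1 / \<epsilon> * (\<rho> - \<sigma>) / T"
          using norm_triangle_sub add_mono order_trans by blast
        then have "Re (line_mean T (\<lambda>t. u (Complex \<sigma> t))) \<le> 1 / \<delta> + (1 / \<epsilon> * (\<rho> - \<sigma>)) * inverse T"
          using complex_Re_le_cmod order_trans unfolding divide_inverse by blast
        then show ?thesis
          by (intro add_left_mono mult_left_mono) auto
      qed
      finally show ?thesis .
    qed
    have "((\<lambda>T. \<Sum>n=1..N. real n powr (- 2 * \<epsilon>) * Q n T) \<longlongrightarrow> (\<Sum>n=1..N. real n powr (- 2 * \<epsilon>) * S n)) at_top"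
      by (intro tendsto_sum tendsto_mult tendsto_const Qlim)
    note lower = this
    have upper: "((\<lambda>T. 1 + K\<^sup>2 / 2 * (1 / \<delta> + (1 / \<epsilon> * (\<rho> - \<sigma>)) * inverse T)) \<longlongrightarrow> 1 + K\<^sup>2 / 2 * (1 / \<delta> + (1 / \<epsilon> * (\<rho> - \<sigma>)) * 0)) at_top"
      by (intro tendsto_intros tendsto_inverse_0_at_top filterlim_ident)
    have "\<forall>\<^sub>F T in at_top. (\<Sum>n=1..N. real n powr (- 2 * \<epsilon>) * Q n T) \<le>
        1 + K\<^sup>2 / 2 * (1 / \<delta> + (1 / \<epsilon> * (\<rho> - \<sigma>)) * inverse T)"
      using eventually_gt_at_top[of 0] by eventually_elim (rule le)
    \<comment> \<open>The error of the shift disappears as \<open>T\<close> tends to infinity, so the bound is free of \<open>\<epsilon>\<close> and \<open>\<sigma>\<close>.\<close>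
    from tendsto_le[OF trivial_limit_at_top_linorder upper lower this]
    show ?thesis by (simp add: S_def)
  qed
  \<comment> \<open>Let \<open>\<epsilon> = \<sigma>\<close> run through \<open>1 / (j + 1)\<close>; the sums are finite.\<close>
  let ?x = "\<lambda>j. inverse (real (Suc j))"
  have lim1: "(\<lambda>j. real n powr (- 2 * ?x j)) \<longlonglongrightarrow> 1" if "n > 0" for n
  proof -
    have "(\<lambda>j. real n powr (- 2 * ?x j)) \<longlonglongrightarrow> real n powr (- 2 * 0)"
      using that by (intro tendsto_intros LIMSEQ_inverse_real_of_nat) auto
    then show ?thesis using that by simp
  qed
  have "(\<lambda>j. \<Sum>n=1..N. real n powr (- 2 * ?x j) * (\<Sum>m=1..M. (cmod (b n m))\<^sup>2 * real m powr (- 2 * ?x j)))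
      \<longlonglongrightarrow> (\<Sum>n=1..N. 1 * (\<Sum>m=1..M. (cmod (b n m))\<^sup>2 * 1))"
    by (intro tendsto_sum tendsto_mult tendsto_const lim1) auto
  then have "(\<Sum>n=1..N. 1 * (\<Sum>m=1..M. (cmod (b n m))\<^sup>2 * 1)) \<le> 1 + K\<^sup>2 / (2 * \<delta>)"
  proof (rule LIMSEQ_le_const2, intro exI[of _ 0] allI impI)
    fix j :: nat
    have "?x j \<le> 1" by (simp add: divide_simps)
    then show "(\<Sum>n=1..N. real n powr (- 2 * ?x j) * (\<Sum>m=1..M. (cmod (b n m))\<^sup>2 * real m powr (- 2 * ?x j))) \<le> 1 + K\<^sup>2 / (2 * \<delta>)"
      using \<rho> by (intro regularised) auto
  qed
  then show ?thesis by simp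
qed

section \<open>Arranging multiplicities in decreasing order\<close>

text \<open>
  The hypothesis makes the number \<open>N x\<close> of elements \<open>\<ge> x\<close>, counted with multiplicity, finite for
  \<open>x > 0\<close>. The sequence is the generalised inverse of \<open>N\<close>: \<open>s n\<close> is the largest \<open>\<sigma>\<close> of positive
  multiplicity with \<open>n < N \<sigma>\<close>, and \<open>0\<close> if there is none. All properties follow from
  \<open>x \<le> s n \<longleftrightarrow> n < N x\<close>.
\<close>

lemma decreasing_rearrangement:
  fixes mult :: "real \<Rightarrow> nat"
  assumes bound: "\<And>F. finite F \<Longrightarrow> F \<subseteq> {0<..} \<Longrightarrow> (\<Sum>\<sigma>\<in>F. real (mult \<sigma>) * \<sigma>\<^sup>2) \<le> H"
  obtains s :: "nat \<Rightarrow> real" where "decseq s" "\<And>n. 0 \<le> s n" "s \<longlonglongrightarrow> 0"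
    "\<And>\<sigma>. 0 < \<sigma> \<Longrightarrow> card {n. s n = \<sigma>} = mult \<sigma>" "summable (\<lambda>n. (s n)\<^sup>2)"
proof -
  define V where "V x = {\<sigma>. x \<le> \<sigma> \<and> 0 < \<sigma> \<and> 0 < mult \<sigma>}" for x
  define N where "N x = (\<Sum>\<sigma>\<in>V x. mult \<sigma>)" for x
  have finV: "finite (V x)" if "0 < x" for x
  proof (rule ccontr)
    assume "infinite (V x)"
    then obtain F where F: "F \<subseteq> V x" "finite F" "card F = nat \<lceil>H / x\<^sup>2\<rceil> + 1"
      using infinite_arbitrarily_large by blast
    have "real (card F) * x\<^sup>2 = (\<Sum>\<sigma>\<in>F. x\<^sup>2)" by simp
    also have "\<dots> \<le> (\<Sum>\<sigma>\<in>F. real (mult \<sigma>) * \<sigma>\<^sup>2)"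
    proof (rule sum_mono)
      fix \<sigma> assume "\<sigma> \<in> F"
      then have "x \<le> \<sigma>" "1 \<le> real (mult \<sigma>)" using F by (auto simp: V_def)
      then have "x\<^sup>2 \<le> \<sigma>\<^sup>2" using that by (intro power_mono) auto
      then show "x\<^sup>2 \<le> real (mult \<sigma>) * \<sigma>\<^sup>2"
        using \<open>1 \<le> real (mult \<sigma>)\<close> mult_right_mono[of 1 "real (mult \<sigma>)" "\<sigma>\<^sup>2"] by simp
    qed
    also have "\<dots> \<le> H" by (rule bound) (use F in \<open>auto simp: V_def\<close>)
    finally have "real (card F) \<le> H / x\<^sup>2" using that by (simp add: field_simps)
    then show False using F(3) by linarith
  qed
  have Nmono: "N y \<le> N x" if "0 < x" "x \<le> y" for x y
    unfolding N_def by (rule sum_mono2) (use that finV in \<open>auto simp: V_def\<close>)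
  define A where "A n = {\<sigma>. 0 < \<sigma> \<and> 0 < mult \<sigma> \<and> n < N \<sigma>}" for n
  have "\<exists>x. (A n = {} \<and> x = 0) \<or> (x \<in> A n \<and> (\<forall>\<tau>\<in>A n. \<tau> \<le> x))" for n
  proof (cases "A n = {}")
    case False
    then obtain x where x: "x \<in> A n" by blast
    let ?B = "A n \<inter> {x..}"
    have "?B \<subseteq> V x" by (auto simp: A_def V_def)
    then have B: "finite ?B" "x \<in> ?B" using finV[of x] x finite_subset by (auto simp: A_def)
    have "Max ?B \<in> ?B" by (rule Max_in) (use B in auto)
    moreover have "\<tau> \<le> Max ?B" if "\<tau> \<in> A n" for \<tau>
    proof (cases "x \<le> \<tau>")
      case True
      then show ?thesis using B(1) that by (intro Max_ge) auto
    next
      case False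
      then show ?thesis using Max_ge[OF B] by linarith
    qed
    ultimately show ?thesis by blast
  qed auto
  then obtain s where s: "\<And>n. (A n = {} \<and> s n = 0) \<or> (s n \<in> A n \<and> (\<forall>\<tau>\<in>A n. \<tau> \<le> s n))"
    by metis
  have nonneg: "0 \<le> s n" for n using s[of n] by (auto simp: A_def)
  have key: "x \<le> s n \<longleftrightarrow> n < N x" if "0 < x" for x n
  proof
    assume "x \<le> s n"
    then have "s n \<in> A n" using s[of n] that by auto
    then have "n < N (s n)" by (simp add: A_def)
    also have "\<dots> \<le> N x" using that \<open>x \<le> s n\<close> by (rule Nmono)
    finally show "n < N x" .
  next
    assume n: "n < N x"
    then have "V x \<noteq> {}" by (auto simp: N_def)
    then have "Min (V x) \<in> V x" using finV[OF that] Min_in by blast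
    moreover have "V (Min (V x)) = V x"
      using \<open>Min (V x) \<in> V x\<close> Min_le[OF finV[OF that]] by (auto simp: V_def intro: order_trans)
    ultimately have "Min (V x) \<in> A n" "x \<le> Min (V x)"
      using n by (auto simp: A_def V_def N_def)
    then show "x \<le> s n" using s[of n] by fastforce
  qed
  have sV: "s n \<in> V (s n)" if "0 < s n" for n
    using s[of n] that by (auto simp: A_def V_def)
  have count: "card {n. s n = \<sigma>} = mult \<sigma> \<and> finite {n. s n = \<sigma>}" if "0 < \<sigma>" for \<sigma>
  proof -
    define W where "W = V \<sigma> - {\<sigma>}"
    have W: "finite W" using finV[OF that] by (simp add: W_def)
    have above: "{n. \<sigma> < s n} = {..<sum mult W}"
    proof (cases "W = {}")
      case True
      have "\<not> \<sigma> < s n" for n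
      proof
        assume "\<sigma> < s n"
        then have "s n \<in> W" using sV[of n] that by (auto simp: W_def V_def)
        then show False using True by simp
      qed
      then show ?thesis using True by auto
    next
      case False
      \<comment> \<open>The next larger value of positive multiplicity.\<close>
      define y where "y = Min W"
      have y: "y \<in> W" "\<And>\<tau>. \<tau> \<in> W \<Longrightarrow> y \<le> \<tau>"
        using False W Min_in Min_le by (auto simp: y_def)
      then have "\<sigma> < y" by (auto simp: W_def V_def)
      moreover have "V y = W" using y \<open>\<sigma> < y\<close> by (force simp: W_def V_def)
      moreover have "\<sigma> < s n \<longleftrightarrow> y \<le> s n" for n
      proof
        assume "\<sigma> < s n"
        then have "s n \<in> W" using sV[of n] that by (auto simp: W_def V_def)
        then show "y \<le> s n" by (rule y(2))
      qed (use \<open>\<sigma> < y\<close> in linarith)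
      ultimately show ?thesis using key[of y] that by (auto simp: N_def)
    qed
    have "N \<sigma> = mult \<sigma> + sum mult W"
    proof (cases "\<sigma> \<in> V \<sigma>")
      case True
      then show ?thesis unfolding N_def W_def using finV[OF that] by (simp add: sum.remove)
    next
      case False
      then have "mult \<sigma> = 0" using that by (auto simp: V_def)
      then show ?thesis using False by (simp add: N_def W_def)
    qed
    moreover have "{n. s n = \<sigma>} = {n. \<sigma> \<le> s n} - {n. \<sigma> < s n}" by auto
    ultimately show ?thesis
      using key[OF that] by (simp add: above card_Diff_subset lessThan_def[symmetric])
  qed
  show ?thesis
  proof
    show "decseq s"
    proof (rule decseq_SucI)
      fix n
      show "s (Suc n) \<le> s n"
        using key[of "s (Suc n)" "Suc n"] key[of "s (Suc n)" n] nonneg[of n] nonneg[of "Suc n"]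
        by (cases "s (Suc n) = 0") auto
    qed
    show "s \<longlonglongrightarrow> 0"
    proof (rule order_tendstoI)
      fix a :: real assume "a < 0"
      then show "\<forall>\<^sub>F n in sequentially. a < s n" using nonneg less_le_trans by (intro always_eventually) blast
    next
      fix a :: real assume "0 < a"
      then have "s n < a" if "n \<ge> N a" for n using key[of a n] that by simp
      then show "\<forall>\<^sub>F n in sequentially. s n < a" unfolding eventually_sequentially by blast
    qed
    show "summable (\<lambda>n. (s n)\<^sup>2)"
    proof (rule summableI_nonneg_bounded)
      fix K
      define I where "I = {n. n < K \<and> 0 < s n}"
      have I: "finite I" by (simp add: I_def)
      have "(\<Sum>n<K. (s n)\<^sup>2) = (\<Sum>n\<in>I. (s n)\<^sup>2)"
        by (rule sum.mono_neutral_right) (use nonneg in \<open>auto simp: I_def less_le\<close>)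
      also have "\<dots> = (\<Sum>\<sigma>\<in>s ` I. \<Sum>n\<in>{n\<in>I. s n = \<sigma>}. (s n)\<^sup>2)"
        by (rule sum.image_gen[OF I])
      also have "\<dots> = (\<Sum>\<sigma>\<in>s ` I. real (card {n\<in>I. s n = \<sigma>}) * \<sigma>\<^sup>2)"
        by (rule sum.cong) auto
      also have "\<dots> \<le> (\<Sum>\<sigma>\<in>s ` I. real (mult \<sigma>) * \<sigma>\<^sup>2)"
      proof (intro sum_mono mult_right_mono)
        fix \<sigma> assume "\<sigma> \<in> s ` I"
        then have "0 < \<sigma>" by (auto simp: I_def)
        then have "card {n\<in>I. s n = \<sigma>} \<le> card {n. s n = \<sigma>}"
          using count by (intro card_mono) auto
        then show "real (card {n\<in>I. s n = \<sigma>}) \<le> real (mult \<sigma>)"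
          using count[OF \<open>0 < \<sigma>\<close>] by simp
      qed simp
      also have "\<dots> \<le> H" by (rule bound) (use I in \<open>auto simp: I_def\<close>)
      finally show "(\<Sum>n<K. (s n)\<^sup>2) \<le> H" .
    qed simp
  qed (use nonneg count in auto)
qed

section \<open>Geometry of the Hilbert space\<close>

lemma h2_coeff_diff: "h2_coeff (f - g) n = h2_coeff f n - h2_coeff g n"
  unfolding minus_h2_def h2_coeff_plus uminus_h2_def h2_coeff_scaleC by simp

lemma h2_coeff_Abs:
  assumes "a 0 = 0" "summable (\<lambda>n. (cmod (a n))\<^sup>2)"
  shows "h2_coeff (Abs_h2 a) n = a n"
  by (subst Abs_h2_inverse) (use assms in auto)

lemma norm_h2_square: "(norm f)\<^sup>2 = (\<Sum>n. (cmod (h2_coeff f n))\<^sup>2)"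
  unfolding norm_h2_def by (intro real_sqrt_pow2 suminf_nonneg summable_h2_coeff) simp

lemma norm_h2_scaleC: "norm (h2_scaleC c f) = cmod c * norm f"
proof -
  have "(norm (h2_scaleC c f))\<^sup>2 = (cmod c * norm f)\<^sup>2"
    unfolding norm_h2_square power_mult_distrib
    by (simp add: norm_mult power_mult_distrib suminf_mult summable_h2_coeff)
  then show ?thesis by (simp add: power2_eq_iff_nonneg)
qed

lemma h2_cinner_add_left: "h2_cinner (f + g) h = h2_cinner f h + h2_cinner g h"
  unfolding h2_cinner_def suminf_add[OF summable_h2_cinner summable_h2_cinner]
  by (simp add: h2_coeff_plus algebra_simps)

lemma h2_cinner_scaleC_left: "h2_cinner (h2_scaleC c f) h = c * h2_cinner f h"
  unfolding h2_cinner_def suminf_mult[OF summable_h2_cinner, symmetric]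
  by (simp add: algebra_simps)

lemma h2_cinner_commute: "h2_cinner f g = cnj (h2_cinner g f)"
proof -
  have "(\<lambda>n. cnj (h2_coeff g n * cnj (h2_coeff f n))) sums cnj (h2_cinner g f)"
    unfolding sums_cnj h2_cinner_def by (rule summable_sums[OF summable_h2_cinner])
  then show ?thesis
    unfolding h2_cinner_def[of f g] by (simp add: sums_iff mult.commute)
qed

lemma h2_cinner_scaleC_right: "h2_cinner f (h2_scaleC c g) = cnj c * h2_cinner f g"
  by (subst (1 2) h2_cinner_commute) (simp add: h2_cinner_scaleC_left)

lemma h2_cinner_zero_left [simp]: "h2_cinner 0 f = 0"
  by (simp add: h2_cinner_def h2_coeff_zero)

lemma h2_cinner_zero_right [simp]: "h2_cinner f 0 = 0"
  by (simp add: h2_cinner_def h2_coeff_zero)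

lemma h2_cinner_sum_left: "h2_cinner (\<Sum>i\<in>A. f i) g = (\<Sum>i\<in>A. h2_cinner (f i) g)"
  by (induction A rule: infinite_finite_induct) (auto simp: h2_cinner_add_left)

lemma h2_cinner_self: "h2_cinner f f = of_real ((norm f)\<^sup>2)"
proof -
  have "(\<lambda>n. of_real ((cmod (h2_coeff f n))\<^sup>2) :: complex) sums of_real ((norm f)\<^sup>2)"
    unfolding sums_of_real_iff norm_h2_square by (rule summable_sums[OF summable_h2_coeff])
  then show ?thesis
    unfolding h2_cinner_def complex_norm_square by (rule sums_unique[symmetric])
qed

lemma h2_diff_scaleC: "f - g = f + h2_scaleC (- 1) g"
  unfolding minus_h2_def uminus_h2_def ..

lemma h2_cinner_diff_left: "h2_cinner (f - g) h = h2_cinner f h - h2_cinner g h"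
  unfolding h2_diff_scaleC h2_cinner_add_left h2_cinner_scaleC_left by simp

text \<open>
  The real Cauchy-Schwarz inequality, after a rotation that makes the complex inner product real and
  nonnegative.
\<close>

lemma cmod_h2_cinner_le: "cmod (h2_cinner f g) \<le> norm f * norm g"
proof -
  define w where "w = cnj (sgn (h2_cinner f g))"
  have "w * h2_cinner f g = of_real (cmod (h2_cinner f g))"
  proof (cases "h2_cinner f g = 0")
    case False
    then show ?thesis
      using complex_norm_square[of "h2_cinner f g"]
      by (simp add: w_def sgn_div_norm scaleR_conv_of_real field_simps power2_eq_square)
  qed simp
  then have "cmod (h2_cinner f g) = inner (h2_scaleC w f) g"
    by (simp add: inner_h2_def h2_cinner_scaleC_left)
  also have "\<dots> \<le> norm (h2_scaleC w f) * norm g"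
    by (rule norm_cauchy_schwarz)
  also have "\<dots> \<le> 1 * norm f * norm g"
    unfolding norm_h2_scaleC by (intro mult_right_mono) (auto simp: w_def norm_sgn)
  finally show ?thesis by simp
qed

definition orthonormal_h2 :: "h2 set \<Rightarrow> bool" where
  "orthonormal_h2 U \<longleftrightarrow> (\<forall>u\<in>U. \<forall>v\<in>U. h2_cinner u v = (if u = v then 1 else 0))"

lemma bessel_inequality:
  assumes "finite U" "orthonormal_h2 U"
  shows "(\<Sum>u\<in>U. (cmod (h2_cinner f u))\<^sup>2) \<le> (norm f)\<^sup>2"
proof -
  define p where "p = (\<Sum>u\<in>U. h2_scaleC (h2_cinner f u) u)"
  have pu: "h2_cinner p u = h2_cinner f u" if "u \<in> U" for u
  proof -
    have "h2_cinner p u = (\<Sum>v\<in>U. h2_cinner f v * (if v = u then 1 else 0))"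
      unfolding p_def h2_cinner_sum_left h2_cinner_scaleC_left
      using assms(2) that by (intro sum.cong) (auto simp: orthonormal_h2_def)
    then show ?thesis using assms(1) that by (simp add: if_distrib cong: if_cong)
  qed
  have gp: "h2_cinner p g = (\<Sum>u\<in>U. h2_cinner f u * h2_cinner u g)" for g
    unfolding p_def h2_cinner_sum_left h2_cinner_scaleC_left ..
  have pf: "h2_cinner p f = of_real (\<Sum>u\<in>U. (cmod (h2_cinner f u))\<^sup>2)"
    unfolding gp of_real_sum complex_norm_square by (subst (2) h2_cinner_commute) simp
  have pp: "h2_cinner p p = of_real (\<Sum>u\<in>U. (cmod (h2_cinner f u))\<^sup>2)"
    unfolding gp of_real_sum complex_norm_square
    by (subst (2) h2_cinner_commute) (simp add: pu)
  have "0 \<le> (norm (f - p))\<^sup>2" by simp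
  also have "\<dots> = inner (f - p) (f - p)" by (rule power2_norm_eq_inner)
  also have "\<dots> = inner f f - 2 * inner p f + inner p p"
    by (simp add: inner_diff_left inner_diff_right inner_commute)
  also have "\<dots> = (norm f)\<^sup>2 - (\<Sum>u\<in>U. (cmod (h2_cinner f u))\<^sup>2)"
    unfolding inner_h2_def pf pp by (simp add: h2_cinner_self)
  finally show ?thesis by simp
qed

text \<open>
  One Gram-Schmidt step per basis vector.
\<close>

lemma exists_orthonormal_in_span:
  assumes "finite B" "h2.independent B"
  shows "\<exists>U. finite U \<and> card U = card B \<and> U \<subseteq> h2.span B \<and> orthonormal_h2 U"
  using assms
proof (induction B rule: finite_induct)
  case empty
  then show ?case by (intro exI[of _ "{}"]) (auto simp: orthonormal_h2_def)
next
  case (insert b B)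
  then have b: "b \<notin> h2.span B" and "h2.independent B"
    using h2.independent_insert[of b B] by auto
  then obtain U where U: "finite U" "card U = card B" "U \<subseteq> h2.span B" "orthonormal_h2 U"
    using insert.IH by blast
  define p where "p = (\<Sum>u\<in>U. h2_scaleC (h2_cinner b u) u)"
  have p: "p \<in> h2.span B"
    unfolding p_def using U(3) by (intro h2.span_sum h2.span_scale) auto
  define q where "q = b - p"
  have "q \<noteq> 0" 
  proof
    assume "q = 0"
    then have "b = p" by (simp add: q_def)
    then show False using b p by simp
  qed
  have "q \<in> h2.span (insert b B)"
    unfolding q_def
    using h2.span_diff[OF h2.span_base[of b "insert b B"], of p] p h2.span_mono[of B "insert b B"] by auto
  have qu: "h2_cinner q u = 0" if "u \<in> U" for u
  proof -
    have "h2_cinner p u = (\<Sum>v\<in>U. h2_cinner b v * (if v = u then 1 else 0))"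
      unfolding p_def h2_cinner_sum_left h2_cinner_scaleC_left
      using U(4) that by (intro sum.cong) (auto simp: orthonormal_h2_def)
    also have "\<dots> = h2_cinner b u" using U(1) that by (simp add: if_distrib cong: if_cong)
    finally show ?thesis by (simp add: q_def h2_cinner_diff_left)
  qed
  define v where "v = h2_scaleC (of_real (inverse (norm q))) q"
  have vv: "h2_cinner v v = 1"
  proof -
    have "norm v = 1" using \<open>q \<noteq> 0\<close> by (simp add: v_def norm_h2_scaleC norm_inverse)
    then show ?thesis by (simp add: h2_cinner_self)
  qed
  have vu: "h2_cinner v u = 0" "h2_cinner u v = 0" if "u \<in> U" for u
    using qu[OF that] h2_cinner_commute[of u q]
    by (auto simp: v_def h2_cinner_scaleC_left h2_cinner_scaleC_right)
  have v: "v \<notin> U" using vv vu(1)[of v] by auto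
  show ?case
  proof (intro exI conjI)
    show "finite (insert v U)" using U(1) by simp
    show "card (insert v U) = card (insert b B)"
      using U(1,2) insert.hyps v by simp
    show "insert v U \<subseteq> h2.span (insert b B)"
      using U(3) h2.span_mono[of B "insert b B"] h2.span_scale[OF \<open>q \<in> _\<close>]
      unfolding v_def by blast
    show "orthonormal_h2 (insert v U)"
      unfolding orthonormal_h2_def
    proof (intro ballI)
      fix x y assume "x \<in> insert v U" "y \<in> insert v U"
      then consider "x = v" "y = v" | "x = v" "y \<in> U" | "x \<in> U" "y = v" | "x \<in> U" "y \<in> U" by blast
      then show "h2_cinner x y = (if x = y then 1 else 0)"
        using U(4) vv vu v unfolding orthonormal_h2_def by cases metis+
    qed
  qed
qed

text \<open>
  The case distinction covers an infinite basis, where \<open>card\<close> and hence \<open>dim\<close> is \<open>0\<close>.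
\<close>

lemma exists_orthonormal_of_dim:
  assumes "h2.subspace E"
  shows "\<exists>U. finite U \<and> card U = h2.dim E \<and> U \<subseteq> E \<and> orthonormal_h2 U"
proof -
  obtain B where B: "B \<subseteq> E" "h2.independent B" "card B = h2.dim E"
    by (rule h2.basis_exists)
  show ?thesis
  proof (cases "finite B")
    case True
    from exists_orthonormal_in_span[OF True B(2)]
    obtain U where U: "finite U" "card U = card B" "U \<subseteq> h2.span B" "orthonormal_h2 U" by blast
    have "U \<subseteq> E" using U(3) h2.span_minimal[OF B(1) assms] by (rule subset_trans)
    with U B(3) show ?thesis by (intro exI[of _ U]) simp
  next
    case False
    then have "h2.dim E = 0" using B(3) by (metis card.infinite)
    then show ?thesis
      by (intro exI[of _ "{}"]) (simp add: orthonormal_h2_def)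
  qed
qed

text \<open>
  The cube is compact for coordinatewise convergence by Tychonoff's theorem, and on it coordinatewise
  convergence is norm convergence by dominated convergence.
\<close>

lemma compact_h2_hilbert_cube:
  assumes "summable (\<lambda>m. (\<rho> m)\<^sup>2)" and nonneg: "\<And>m. 0 \<le> \<rho> m"
  shows "compact {h. \<forall>m. cmod (h2_coeff h m) \<le> \<rho> m}"
proof -
  let ?K = "{h. \<forall>m. cmod (h2_coeff h m) \<le> \<rho> m}"
  have "seq_compact ?K"
    unfolding seq_compact_def
  proof (intro allI impI)
    fix h :: "nat \<Rightarrow> h2" assume h: "\<forall>k. h k \<in> ?K"
    have "\<exists>l r. strict_mono (r :: nat \<Rightarrow> nat) \<and> (\<lambda>k. h2_coeff (h (r k))) \<longlonglongrightarrow> l"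
    proof -
      have "compact (PiE UNIV (\<lambda>m. cball (0 :: complex) (\<rho> m)))"
      proof -
        have "compactin (product_topology (\<lambda>m :: nat. euclidean) UNIV) (PiE UNIV (\<lambda>m. cball (0 :: complex) (\<rho> m)))"
          by (subst compactin_PiE) auto
        then show ?thesis by (simp add: euclidean_product_topology)
      qed
      then have seq: "seq_compact (PiE UNIV (\<lambda>m. cball (0 :: complex) (\<rho> m)))"
        by (rule compact_imp_seq_compact)
      have mem: "h2_coeff (h k) \<in> PiE UNIV (\<lambda>m. cball (0 :: complex) (\<rho> m))" for k
        using h by auto
      have "\<exists>l\<in>PiE UNIV (\<lambda>m. cball (0 :: complex) (\<rho> m)). \<exists>r.
          strict_mono (r :: nat \<Rightarrow> nat) \<and> ((\<lambda>k. h2_coeff (h k)) \<circ> r) \<longlonglongrightarrow> l"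
        using mem by (intro spec[OF seq[unfolded seq_compact_def], THEN mp]) blast
      then show ?thesis unfolding o_def by blast
    qed
    then obtain l r where r: "strict_mono (r :: nat \<Rightarrow> nat)" and l: "(\<lambda>k. h2_coeff (h (r k))) \<longlonglongrightarrow> l"
      by blast
    have lim: "(\<lambda>k. h2_coeff (h (r k)) m) \<longlonglongrightarrow> l m" for m
    proof -
      have "continuous_on UNIV (\<lambda>x :: nat \<Rightarrow> complex. x m)"
        by (rule continuous_on_product_coordinates)
      from continuous_on_tendsto_compose[OF this l] show ?thesis by simp
    qed
    have le: "cmod (l m) \<le> \<rho> m" for m
      by (rule LIMSEQ_le_const2[OF tendsto_norm[OF lim[of m]]]) (use h in auto)
    have "l 0 = 0" using LIMSEQ_unique[OF lim[of 0]] by simp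
    moreover have "summable (\<lambda>m. (cmod (l m))\<^sup>2)"
      using assms(1) by (rule summable_comparison_test') (use le in \<open>auto intro: power_mono\<close>)
    ultimately have cl: "h2_coeff (Abs_h2 l) m = l m" for m
      by (rule h2_coeff_Abs)
    have "(\<lambda>k. \<Sum>m. (cmod (h2_coeff (h (r k)) m - l m))\<^sup>2) \<longlonglongrightarrow> (\<Sum>m. 0)"
    proof (rule tannerys_theorem[THEN conjunct2, THEN conjunct2])
      show "(\<lambda>k. (cmod (h2_coeff (h (r k)) m - l m))\<^sup>2) \<longlonglongrightarrow> 0" for m
        using tendsto_power[OF tendsto_norm[OF tendsto_diff[OF lim[of m] tendsto_const[of "l m"]]], of 2] by simp
      show "summable (\<lambda>m. 4 * (\<rho> m)\<^sup>2)" by (intro summable_mult assms(1))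
      have "norm ((cmod (h2_coeff (h (r k)) m - l m))\<^sup>2) \<le> 4 * (\<rho> m)\<^sup>2" for m k
      proof -
        have "cmod (h2_coeff (h (r k)) m - l m) \<le> \<rho> m + \<rho> m"
          using h le by (intro norm_triangle_le_diff add_mono) auto
        then have "(cmod (h2_coeff (h (r k)) m - l m))\<^sup>2 \<le> (2 * \<rho> m)\<^sup>2"
          by (intro power_mono) auto
        then show ?thesis by (simp add: power_mult_distrib)
      qed
      then show "\<forall>\<^sub>F (m, k) in sequentially \<times>\<^sub>F sequentially.
          norm ((cmod (h2_coeff (h (r k)) m - l m))\<^sup>2) \<le> 4 * (\<rho> m)\<^sup>2"
        by (intro always_eventually) auto
    qed simp
    then have "(\<lambda>k. (norm (h (r k) - Abs_h2 l))\<^sup>2) \<longlonglongrightarrow> 0"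
      by (simp add: norm_h2_square h2_coeff_diff cl)
    from tendsto_real_sqrt[OF this] have "(\<lambda>k. norm (h (r k) - Abs_h2 l)) \<longlonglongrightarrow> 0"
      by simp
    then have "(h \<circ> r) \<longlonglongrightarrow> Abs_h2 l"
      unfolding o_def by (rule LIM_zero_cancel[OF tendsto_norm_zero_cancel])
    moreover have "Abs_h2 l \<in> ?K" using le cl by auto
    ultimately show "\<exists>l\<in>?K. \<exists>r. strict_mono r \<and> (h \<circ> r) \<longlonglongrightarrow> l"
      using r by blast
  qed
  then show ?thesis by (simp add: compact_eq_seq_compact_metric)
qed

section \<open>Hilbert-Schmidt operators\<close>

text \<open>
  The entry \<open>b n m\<close> is the coefficient with index \<open>m\<close> of the image of the basis vector with index \<open>n\<close>.
  The entries with an index \<open>0\<close> vanish because coefficient sequences vanish at \<open>0\<close>.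
\<close>

definition hilbert_schmidt_matrix :: "(nat \<Rightarrow> nat \<Rightarrow> complex) \<Rightarrow> bool" where
  "hilbert_schmidt_matrix b \<longleftrightarrow> (\<forall>m. b 0 m = 0) \<and> (\<forall>n. b n 0 = 0) \<and>
     (\<lambda>(n, m). (cmod (b n m))\<^sup>2) summable_on UNIV"

definition matrix_operator :: "(nat \<Rightarrow> nat \<Rightarrow> complex) \<Rightarrow> h2 \<Rightarrow> h2" where
  "matrix_operator b f = Abs_h2 (\<lambda>m. \<Sum>n. h2_coeff f n * b n m)"

definition conj_transpose :: "(nat \<Rightarrow> nat \<Rightarrow> complex) \<Rightarrow> nat \<Rightarrow> nat \<Rightarrow> complex" where
  "conj_transpose b m n = cnj (b n m)"

text \<open>
  The conjugation makes coefficient \<open>m\<close> of the image of \<open>f\<close> the inner product of \<open>f\<close> with \<open>conj_column b m\<close>.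
\<close>

definition conj_column :: "(nat \<Rightarrow> nat \<Rightarrow> complex) \<Rightarrow> nat \<Rightarrow> h2" where
  "conj_column b m = Abs_h2 (\<lambda>n. cnj (b n m))"

definition hilbert_schmidt_norm_sq :: "(nat \<Rightarrow> nat \<Rightarrow> complex) \<Rightarrow> real" where
  "hilbert_schmidt_norm_sq b = (\<Sum>\<^sub>\<infinity>(n, m)\<in>UNIV. (cmod (b n m))\<^sup>2)"

lemma hilbert_schmidt_conj_transpose:
  assumes "hilbert_schmidt_matrix b"
  shows "hilbert_schmidt_matrix (conj_transpose b)"
proof -
  have "(\<lambda>(n, m). (cmod (b n m))\<^sup>2) summable_on UNIV \<times> UNIV"
    using assms by (simp add: hilbert_schmidt_matrix_def)
  then have "(\<lambda>(n, m). (cmod (b m n))\<^sup>2) summable_on UNIV \<times> UNIV"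
    using summable_on_swap[of "\<lambda>(n, m). (cmod (b n m))\<^sup>2" UNIV UNIV] by (simp add: case_prod_unfold)
  then show ?thesis
    using assms by (simp add: hilbert_schmidt_matrix_def conj_transpose_def)
qed

lemma summable_column:
  assumes "hilbert_schmidt_matrix b"
  shows "summable (\<lambda>n. (cmod (b n m))\<^sup>2)"
proof -
  have "(\<lambda>(n, m). (cmod (conj_transpose b n m))\<^sup>2) summable_on UNIV \<times> UNIV"
    using hilbert_schmidt_conj_transpose[OF assms] by (simp add: hilbert_schmidt_matrix_def)
  from summable_on_SigmaD1[OF this, of m] have "(\<lambda>n. (cmod (b n m))\<^sup>2) summable_on UNIV"
    by (simp add: conj_transpose_def)
  then show ?thesis by (rule summable_on_imp_summable)
qed

lemma h2_coeff_column:
  assumes "hilbert_schmidt_matrix b"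
  shows "h2_coeff (conj_column b m) n = cnj (b n m)"
  unfolding conj_column_def
  by (rule h2_coeff_Abs) (use assms summable_column[OF assms] in \<open>auto simp: hilbert_schmidt_matrix_def\<close>)

lemma norm_columns_sums:
  assumes "hilbert_schmidt_matrix b"
  shows "(\<lambda>m. (norm (conj_column b m))\<^sup>2) sums hilbert_schmidt_norm_sq b"
proof -
  have "((\<lambda>(n, m). (cmod (b n m))\<^sup>2) has_sum hilbert_schmidt_norm_sq b) (UNIV \<times> UNIV)"
    using assms by (simp add: hilbert_schmidt_matrix_def hilbert_schmidt_norm_sq_def)
  then have "((\<lambda>(m, n). (cmod (b n m))\<^sup>2) has_sum hilbert_schmidt_norm_sq b) (UNIV \<times> UNIV)"
    by (subst (asm) has_sum_swap) (simp add: case_prod_unfold)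
  then have "((\<lambda>m. (norm (conj_column b m))\<^sup>2) has_sum hilbert_schmidt_norm_sq b) UNIV"
  proof (rule has_sum_SigmaD)
    fix m
    have "summable (\<lambda>n. norm ((cmod (b n m))\<^sup>2))" using summable_column[OF assms] by simp
    moreover have "(\<lambda>n. (cmod (b n m))\<^sup>2) sums (norm (conj_column b m))\<^sup>2"
      unfolding norm_h2_square h2_coeff_column[OF assms]
      using summable_sums[OF summable_column[OF assms]] by simp
    ultimately show "((\<lambda>n. case (m, n) of (m, n) \<Rightarrow> (cmod (b n m))\<^sup>2) has_sum (norm (conj_column b m))\<^sup>2) UNIV"
      by (simp add: norm_summable_imp_has_sum)
  qed
  then show ?thesis by (rule has_sum_imp_sums)
qed

lemma cmod_h2_cinner_column_le: "(cmod (h2_cinner f (conj_column b m)))\<^sup>2 \<le> (norm f)\<^sup>2 * (norm (conj_column b m))\<^sup>2"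
  using power_mono[OF cmod_h2_cinner_le, of f "conj_column b m" 2] by (simp add: power_mult_distrib)

lemma h2_coeff_matrix_operator:
  assumes "hilbert_schmidt_matrix b"
  shows "h2_coeff (matrix_operator b f) m = h2_cinner f (conj_column b m)"
proof -
  have eq: "(\<Sum>n. h2_coeff f n * b n m) = h2_cinner f (conj_column b m)" for m
    unfolding h2_cinner_def h2_coeff_column[OF assms] by simp
  have "conj_column b 0 = 0"
    using assms by (intro h2_eqI) (simp add: h2_coeff_column h2_coeff_zero hilbert_schmidt_matrix_def)
  moreover have "summable (\<lambda>m. (cmod (h2_cinner f (conj_column b m)))\<^sup>2)"
  proof (rule summable_comparison_test')
    show "summable (\<lambda>m. (norm f)\<^sup>2 * (norm (conj_column b m))\<^sup>2)"
      using norm_columns_sums[OF assms] by (intro summable_mult) (simp add: sums_iff)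
  qed (use cmod_h2_cinner_column_le in simp)
  ultimately show ?thesis
    unfolding matrix_operator_def eq by (intro h2_coeff_Abs) auto
qed

lemma norm_matrix_operator_le:
  assumes "hilbert_schmidt_matrix b"
  shows "norm (matrix_operator b f) \<le> norm f * sqrt (hilbert_schmidt_norm_sq b)"
proof -
  have s: "summable (\<lambda>m. (norm (conj_column b m))\<^sup>2)" and H: "(\<Sum>m. (norm (conj_column b m))\<^sup>2) = hilbert_schmidt_norm_sq b"
    using norm_columns_sums[OF assms] by (auto simp: sums_iff)
  have "(norm (matrix_operator b f))\<^sup>2 \<le> (\<Sum>m. (norm f)\<^sup>2 * (norm (conj_column b m))\<^sup>2)"
    unfolding norm_h2_square[of "matrix_operator b f"]
    by (intro suminf_le summable_h2_coeff summable_mult s)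
      (simp add: h2_coeff_matrix_operator[OF assms] cmod_h2_cinner_column_le)
  also have "\<dots> = (norm f)\<^sup>2 * hilbert_schmidt_norm_sq b"
    by (simp add: suminf_mult[OF s] H)
  finally have "sqrt ((norm (matrix_operator b f))\<^sup>2) \<le> sqrt ((norm f)\<^sup>2 * hilbert_schmidt_norm_sq b)"
    by (rule real_sqrt_le_mono)
  then show ?thesis by (simp add: real_sqrt_mult)
qed

lemma matrix_operator_scaleC:
  assumes "hilbert_schmidt_matrix b"
  shows "matrix_operator b (h2_scaleC c f) = h2_scaleC c (matrix_operator b f)"
  by (intro h2_eqI) (simp add: h2_coeff_matrix_operator[OF assms] h2_cinner_scaleC_left)

lemma bounded_operator_matrix_operator:
  assumes "hilbert_schmidt_matrix b"
  shows "bounded_operator_h2 (matrix_operator b)"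
  unfolding bounded_operator_h2_def
proof (intro conjI allI)
  show "bounded_linear (matrix_operator b)"
  proof (rule bounded_linear_intro)
    show "matrix_operator b (f + g) = matrix_operator b f + matrix_operator b g" for f g
      by (intro h2_eqI) (simp add: h2_coeff_matrix_operator[OF assms] h2_cinner_add_left h2_coeff_plus)
    show "matrix_operator b (r *\<^sub>R f) = r *\<^sub>R matrix_operator b f" for r f
      unfolding scaleR_h2_def by (rule matrix_operator_scaleC[OF assms])
    show "norm (matrix_operator b f) \<le> norm f * sqrt (hilbert_schmidt_norm_sq b)" for f
      by (rule norm_matrix_operator_le[OF assms])
  qed
qed (rule matrix_operator_scaleC[OF assms])

lemma compact_matrix_operator:
  assumes "hilbert_schmidt_matrix b"
  shows "compact_operator_h2 (matrix_operator b)"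
  unfolding compact_operator_h2_def
proof
  let ?K = "{h. \<forall>m. cmod (h2_coeff h m) \<le> norm (conj_column b m)}"
  have K: "compact ?K"
    using norm_columns_sums[OF assms] by (intro compact_h2_hilbert_cube) (auto simp: sums_iff)
  have "matrix_operator b f \<in> ?K" if "f \<in> cball 0 1" for f
  proof -
    have "cmod (h2_cinner f (conj_column b m)) \<le> 1 * norm (conj_column b m)" for m
      using that cmod_h2_cinner_le[of f "conj_column b m"] mult_right_mono[of "norm f" 1 "norm (conj_column b m)"]
      by (simp add: dist_norm)
    then show ?thesis by (simp add: h2_coeff_matrix_operator[OF assms])
  qed
  then have "closure (matrix_operator b ` cball 0 1) \<subseteq> ?K"
    using compact_imp_closed[OF K] by (intro closure_minimal) auto
  then have "closure (matrix_operator b ` cball 0 1) = ?K \<inter> closure (matrix_operator b ` cball 0 1)"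
    by blast
  then show "compact (closure (matrix_operator b ` cball 0 1))"
    using compact_Int_closed[OF K closed_closure] by metis
qed (rule bounded_operator_matrix_operator[OF assms])

lemma mult_le_sum_squares:
  fixes a b :: real
  assumes "0 \<le> a" "0 \<le> b"
  shows "a * b \<le> a\<^sup>2 + b\<^sup>2"
proof -
  have "0 \<le> a * b" using assms by simp
  then show ?thesis using sum_squares_bound[of a b] unfolding mult.assoc by linarith
qed

lemma summable_mult_square_summable:
  fixes x y :: "nat \<Rightarrow> complex"
  assumes "summable (\<lambda>n. (cmod (x n))\<^sup>2)" "summable (\<lambda>n. (cmod (y n))\<^sup>2)"
  shows "summable (\<lambda>n. norm (x n * y n))"
  by (rule summable_comparison_test'[OF summable_add[OF assms], where N = 0])
    (simp add: norm_mult mult_le_sum_squares)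

text \<open>
  The family is absolutely summable over pairs since both \<open>x n * y m\<close> and \<open>b n m\<close> are square summable
  over pairs. The lemma serves twice: for the adjoint, and, with \<open>y m = m powr - s\<close>, for the
  evaluation of the image at a point.
\<close>

lemma bilinear_form_swap:
  assumes hs: "hilbert_schmidt_matrix b"
    and x: "summable (\<lambda>n. (cmod (x n))\<^sup>2)" and y: "summable (\<lambda>m. (cmod (y m))\<^sup>2)"
  shows "(\<Sum>n. x n * (\<Sum>m. b n m * y m)) = (\<Sum>m. (\<Sum>n. x n * b n m) * y m)"
proof -
  have nat: "infsum f UNIV = suminf f" if "f summable_on UNIV" for f :: "nat \<Rightarrow> complex"
    using has_sum_imp_sums[OF has_sum_infsum[OF that]] by (simp add: sums_iff)
  have xy: "(\<lambda>(n, m). (cmod (x n))\<^sup>2 * (cmod (y m))\<^sup>2) summable_on UNIV \<times> UNIV"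
  proof (rule summable_on_SigmaI)
    show "((\<lambda>m. case (n, m) of (n, m) \<Rightarrow> (cmod (x n))\<^sup>2 * (cmod (y m))\<^sup>2) has_sum
        (cmod (x n))\<^sup>2 * (\<Sum>m. (cmod (y m))\<^sup>2)) UNIV" for n
      using y by (simp add: norm_summable_imp_has_sum has_sum_cmult_right summable_sums)
    show "(\<lambda>n. (cmod (x n))\<^sup>2 * (\<Sum>m. (cmod (y m))\<^sup>2)) summable_on UNIV"
      using x by (intro summable_on_cmult_left norm_summable_imp_summable_on) simp
  qed auto
  have "(\<lambda>(n, m). (cmod (x n))\<^sup>2 * (cmod (y m))\<^sup>2 + (cmod (b n m))\<^sup>2) summable_on UNIV \<times> UNIV"
    using summable_on_add[OF xy, of "\<lambda>(n, m). (cmod (b n m))\<^sup>2"] hs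
    by (simp add: hilbert_schmidt_matrix_def case_prod_unfold)
  then have "(\<lambda>(n, m). norm (x n * b n m * y m)) summable_on UNIV \<times> UNIV"
  proof (rule summable_on_comparison_test)
    fix p :: "nat \<times> nat"
    obtain n m where p: "p = (n, m)" by (cases p)
    have "norm (x n * b n m * y m) = (cmod (x n) * cmod (y m)) * cmod (b n m)"
      by (simp add: norm_mult)
    also have "\<dots> \<le> (cmod (x n) * cmod (y m))\<^sup>2 + (cmod (b n m))\<^sup>2"
      by (intro mult_le_sum_squares) auto
    finally show "(case p of (n, m) \<Rightarrow> norm (x n * b n m * y m)) \<le>
        (case p of (n, m) \<Rightarrow> (cmod (x n))\<^sup>2 * (cmod (y m))\<^sup>2 + (cmod (b n m))\<^sup>2)"
      by (simp add: p power_mult_distrib)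
  qed auto
  then have "(\<lambda>p. norm (case p of (n, m) \<Rightarrow> x n * b n m * y m)) summable_on UNIV \<times> UNIV"
    by (simp add: case_prod_unfold)
  then have S: "(\<lambda>(n, m). x n * b n m * y m) summable_on UNIV \<times> UNIV"
    by (rule Infinite_Sum.abs_summable_summable)
  then have S': "(\<lambda>(m, n). x n * b n m * y m) summable_on UNIV \<times> UNIV"
    by (subst (asm) summable_on_swap) (simp add: case_prod_unfold)
  have row: "summable (\<lambda>m. (cmod (b n m))\<^sup>2)" for n
    using summable_column[OF hilbert_schmidt_conj_transpose[OF hs], of n] by (simp add: conj_transpose_def)
  have inner1: "infsum (\<lambda>m. x n * b n m * y m) UNIV = x n * (\<Sum>m. b n m * y m)" for n
  proof -
    have "summable (\<lambda>m. b n m * y m)"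
      by (rule summable_norm_cancel[OF summable_mult_square_summable[OF row y]])
    then show ?thesis
      using nat[of "\<lambda>m. x n * b n m * y m"] summable_on_SigmaD1[OF S, of n]
      by (simp add: mult.assoc suminf_mult)
  qed
  have inner2: "infsum (\<lambda>n. x n * b n m * y m) UNIV = (\<Sum>n. x n * b n m) * y m" for m
  proof -
    have "summable (\<lambda>n. x n * b n m)"
      by (rule summable_norm_cancel[OF summable_mult_square_summable[OF x summable_column[OF hs]]])
    then show ?thesis
      using nat[of "\<lambda>n. x n * b n m * y m"] summable_on_SigmaD1[OF S', of m]
      by (simp add: suminf_mult2)
  qed
  have "(\<lambda>n. infsum (\<lambda>m. x n * b n m * y m) UNIV) summable_on UNIV"
    using summable_on_Sigma_banach[OF S] .
  from nat[OF this] have "(\<Sum>n. x n * (\<Sum>m. b n m * y m)) =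
      infsum (\<lambda>n. infsum (\<lambda>m. x n * b n m * y m) UNIV) UNIV"
    by (simp add: inner1)
  also have "\<dots> = infsum (\<lambda>m. infsum (\<lambda>n. x n * b n m * y m) UNIV) UNIV"
    by (rule infsum_swap_banach[OF S])
  also have "\<dots> = (\<Sum>m. (\<Sum>n. x n * b n m) * y m)"
    using nat[OF summable_on_Sigma_banach[OF S']] by (simp add: inner2)
  finally show ?thesis .
qed

lemma matrix_operator_adjoint:
  assumes hs: "hilbert_schmidt_matrix b"
  shows "h2_cinner (matrix_operator b f) g = h2_cinner f (matrix_operator (conj_transpose b) g)"
proof -
  have hs': "hilbert_schmidt_matrix (conj_transpose b)"
    using hs by (rule hilbert_schmidt_conj_transpose)
  have inner: "(\<Sum>m. b n m * cnj (h2_coeff g m)) = cnj (h2_coeff (matrix_operator (conj_transpose b) g) n)" for n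
    unfolding h2_coeff_matrix_operator[OF hs']
    by (subst h2_cinner_commute) (simp add: h2_cinner_def h2_coeff_column[OF hs'] conj_transpose_def)
  have "h2_cinner (matrix_operator b f) g = (\<Sum>m. (\<Sum>n. h2_coeff f n * b n m) * cnj (h2_coeff g m))"
    unfolding h2_cinner_def[of "matrix_operator b f"] h2_coeff_matrix_operator[OF hs]
    by (simp add: h2_cinner_def h2_coeff_column[OF hs])
  also have "\<dots> = (\<Sum>n. h2_coeff f n * (\<Sum>m. b n m * cnj (h2_coeff g m)))"
    by (rule bilinear_form_swap[OF hs, symmetric]) (auto simp: summable_h2_coeff)
  also have "\<dots> = h2_cinner f (matrix_operator (conj_transpose b) g)"
    unfolding inner h2_cinner_def ..
  finally show ?thesis .
qed

lemma h2_adjoint_matrix_operator: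
  assumes hs: "hilbert_schmidt_matrix b"
  shows "h2_adjoint (matrix_operator b) = matrix_operator (conj_transpose b)"
  unfolding h2_adjoint_def
proof (rule the_equality)
  show "\<forall>f g. h2_cinner (matrix_operator b f) g = h2_cinner f (matrix_operator (conj_transpose b) g)"
    using matrix_operator_adjoint[OF hs] by blast
next
  fix S assume S: "\<forall>f g. h2_cinner (matrix_operator b f) g = h2_cinner f (S g)"
  show "S = matrix_operator (conj_transpose b)"
  proof
    fix g
    let ?d = "S g - matrix_operator (conj_transpose b) g"
    have "h2_cinner ?d (S g) = h2_cinner ?d (matrix_operator (conj_transpose b) g)"
      using S matrix_operator_adjoint[OF hs] by metis
    then have "h2_cinner (S g) ?d = h2_cinner (matrix_operator (conj_transpose b) g) ?d"
      by (metis h2_cinner_commute)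
    then have "h2_cinner ?d ?d = 0"
      unfolding h2_cinner_diff_left[of "S g"] by simp
    then show "S g = matrix_operator (conj_transpose b) g"
      by (simp add: h2_cinner_self)
  qed
qed

text \<open>
  Bessel's inequality for each column, summed over the columns.
\<close>

lemma hilbert_schmidt_orthonormal_bound:
  assumes hs: "hilbert_schmidt_matrix b" and U: "finite U" "orthonormal_h2 U"
  shows "(\<Sum>u\<in>U. (norm (matrix_operator b u))\<^sup>2) \<le> hilbert_schmidt_norm_sq b"
proof -
  have sm: "summable (\<lambda>m. (cmod (h2_cinner u (conj_column b m)))\<^sup>2)" for u
    using summable_h2_coeff[of "matrix_operator b u"] by (simp add: h2_coeff_matrix_operator[OF hs])
  have "(\<Sum>u\<in>U. (norm (matrix_operator b u))\<^sup>2) = (\<Sum>u\<in>U. \<Sum>m. (cmod (h2_cinner u (conj_column b m)))\<^sup>2)"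
    by (simp add: norm_h2_square h2_coeff_matrix_operator[OF hs])
  also have "\<dots> = (\<Sum>m. \<Sum>u\<in>U. (cmod (h2_cinner u (conj_column b m)))\<^sup>2)"
    by (rule suminf_sum[symmetric]) (rule sm)
  also have "\<dots> \<le> (\<Sum>m. (norm (conj_column b m))\<^sup>2)"
  proof (rule suminf_le)
    fix m
    have "cmod (h2_cinner u (conj_column b m)) = cmod (h2_cinner (conj_column b m) u)" for u
      by (subst h2_cinner_commute) simp
    then show "(\<Sum>u\<in>U. (cmod (h2_cinner u (conj_column b m)))\<^sup>2) \<le> (norm (conj_column b m))\<^sup>2"
      using bessel_inequality[OF U, of "conj_column b m"] by simp
  qed (use norm_columns_sums[OF hs] sm in \<open>auto simp: sums_iff intro: summable_sum\<close>)
  also have "\<dots> = hilbert_schmidt_norm_sq b" using norm_columns_sums[OF hs] by (simp add: sums_iff)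
  finally show ?thesis .
qed

text \<open>
  Choose in each eigenspace \<open>E \<sigma>\<close> of \<open>T\<^sup>* T\<close> an orthonormal set of \<open>dim (E \<sigma>)\<close> vectors; \<open>T\<close> scales
  their norms by \<open>\<sigma>\<close>. Eigenvectors for different eigenvalues are orthogonal, so finitely many such
  sets together are orthonormal, and \<open>hilbert_schmidt_orthonormal_bound\<close> bounds
  \<open>\<Sum> dim (E \<sigma>) * \<sigma>\<^sup>2\<close>.
\<close>

lemma hilbert_schmidt_singular_values:
  assumes hs: "hilbert_schmidt_matrix b"
  obtains s where "singular_value_seq (matrix_operator b) s" "summable (\<lambda>n. (s n)\<^sup>2)"
proof -
  let ?T = "matrix_operator b" and ?S = "matrix_operator (conj_transpose b)"
  define E where "E \<sigma> = {f. ?S (?T f) = h2_scaleC (of_real (\<sigma>\<^sup>2)) f}" for \<sigma> :: real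
  have hs': "hilbert_schmidt_matrix (conj_transpose b)"
    using hs by (rule hilbert_schmidt_conj_transpose)
  have lin: "?S (?T (f + g)) = ?S (?T f) + ?S (?T g)" "?S (?T 0) = 0" for f g
    using bounded_operator_matrix_operator[OF hs] bounded_operator_matrix_operator[OF hs']
    by (simp_all add: bounded_operator_h2_def linear_add linear_0 bounded_linear.linear)
  have sub: "h2.subspace (E \<sigma>)" for \<sigma>
    by (auto simp: h2.subspace_def E_def lin matrix_operator_scaleC[OF hs] matrix_operator_scaleC[OF hs']
        h2.scale_right_distrib h2.scale_left_commute)
  have TT: "h2_cinner (?T f) (?T g) = of_real (\<sigma>\<^sup>2) * h2_cinner f g" if "g \<in> E \<sigma>" for f g \<sigma>
    using that by (simp add: matrix_operator_adjoint[OF hs] E_def h2_cinner_scaleC_right)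
  have orth: "h2_cinner f g = 0" if "f \<in> E \<sigma>" "g \<in> E \<tau>" "0 < \<sigma>" "0 < \<tau>" "\<sigma> \<noteq> \<tau>" for f g \<sigma> \<tau>
  proof -
    have "of_real (\<sigma>\<^sup>2) * h2_cinner f g = cnj (of_real (\<sigma>\<^sup>2) * h2_cinner g f)"
      using h2_cinner_commute[of f g] by simp
    also have "\<dots> = cnj (h2_cinner (?T g) (?T f))"
      by (simp only: TT[OF that(1)])
    also have "\<dots> = of_real (\<tau>\<^sup>2) * h2_cinner f g"
      using TT[OF that(2), of f] h2_cinner_commute[of "?T f" "?T g"] by simp
    finally have "(of_real (\<sigma>\<^sup>2) - of_real (\<tau>\<^sup>2)) * h2_cinner f g = 0"
      by (simp add: algebra_simps)
    moreover have "\<sigma>\<^sup>2 \<noteq> \<tau>\<^sup>2" using that(3-5) by (simp add: power2_eq_iff)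
    then have "complex_of_real (\<sigma>\<^sup>2) \<noteq> of_real (\<tau>\<^sup>2)" by (metis of_real_eq_iff)
    ultimately show ?thesis by simp
  qed
  have "\<exists>U. finite U \<and> card U = h2.dim (E \<sigma>) \<and> U \<subseteq> E \<sigma> \<and> orthonormal_h2 U" for \<sigma>
    by (rule exists_orthonormal_of_dim[OF sub])
  then obtain U where U: "\<And>\<sigma>. finite (U \<sigma>)" "\<And>\<sigma>. card (U \<sigma>) = h2.dim (E \<sigma>)"
      "\<And>\<sigma>. U \<sigma> \<subseteq> E \<sigma>" "\<And>\<sigma>. orthonormal_h2 (U \<sigma>)"
    by metis
  have bound: "(\<Sum>\<sigma>\<in>F. real (h2.dim (E \<sigma>)) * \<sigma>\<^sup>2) \<le> hilbert_schmidt_norm_sq b" if F: "finite F" "F \<subseteq> {0<..}" for F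
  proof -
    have un: "h2_cinner u u = 1" if "u \<in> U \<sigma>" for u \<sigma>
      using U(4)[of \<sigma>] that by (simp add: orthonormal_h2_def)
    have uv: "h2_cinner u v = 0" if "u \<in> U \<sigma>" "v \<in> U \<tau>" "\<sigma> \<in> F" "\<tau> \<in> F" "\<sigma> \<noteq> \<tau>" for u v \<sigma> \<tau>
      using orth[of u \<sigma> v \<tau>] U(3) that F(2) by blast
    have disj: "U \<sigma> \<inter> U \<tau> = {}" if "\<sigma> \<in> F" "\<tau> \<in> F" "\<sigma> \<noteq> \<tau>" for \<sigma> \<tau>
    proof (rule ccontr)
      assume "U \<sigma> \<inter> U \<tau> \<noteq> {}"
      then obtain u where "u \<in> U \<sigma>" "u \<in> U \<tau>" by blast
      then show False using un[of u \<sigma>] uv[of u \<sigma> u \<tau>] that by simp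
    qed
    have ortho: "orthonormal_h2 (\<Union>\<sigma>\<in>F. U \<sigma>)"
      unfolding orthonormal_h2_def
    proof (intro ballI)
      fix u v assume "u \<in> (\<Union>\<sigma>\<in>F. U \<sigma>)" "v \<in> (\<Union>\<sigma>\<in>F. U \<sigma>)"
      then obtain \<sigma> \<tau> where *: "\<sigma> \<in> F" "u \<in> U \<sigma>" "\<tau> \<in> F" "v \<in> U \<tau>" by blast
      show "h2_cinner u v = (if u = v then 1 else 0)"
      proof (cases "\<sigma> = \<tau>")
        case True
        then show ?thesis using U(4)[of \<sigma>] * by (simp add: orthonormal_h2_def)
      next
        case False
        then have "u \<noteq> v" using disj[of \<sigma> \<tau>] * by blast
        then show ?thesis using uv[of u \<sigma> v \<tau>] * False by simp
      qed
    qed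
    have normT: "(norm (?T u))\<^sup>2 = \<sigma>\<^sup>2" if "u \<in> U \<sigma>" for u \<sigma>
    proof -
      have "complex_of_real ((norm (?T u))\<^sup>2) = of_real (\<sigma>\<^sup>2)"
        using TT[of u \<sigma> u] U(3)[of \<sigma>] that un[OF that] by (auto simp: h2_cinner_self[of "?T u", symmetric] simp del: of_real_power)
      then show ?thesis by (simp only: of_real_eq_iff)
    qed
    have "(\<Sum>\<sigma>\<in>F. real (h2.dim (E \<sigma>)) * \<sigma>\<^sup>2) = (\<Sum>\<sigma>\<in>F. \<Sum>u\<in>U \<sigma>. (norm (?T u))\<^sup>2)"
      by (rule sum.cong[OF refl]) (simp add: normT U(2))
    also have "\<dots> = (\<Sum>u\<in>(\<Union>\<sigma>\<in>F. U \<sigma>). (norm (?T u))\<^sup>2)"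
      by (rule sum.UNION_disjoint[symmetric]) (use F U(1) disj in auto)
    also have "\<dots> \<le> hilbert_schmidt_norm_sq b"
      by (rule hilbert_schmidt_orthonormal_bound[OF hs _ ortho]) (use F U(1) in auto)
    finally show ?thesis .
  qed
  obtain s :: "nat \<Rightarrow> real" where s: "decseq s" "\<And>n. 0 \<le> s n" "s \<longlonglongrightarrow> 0"
    "\<And>\<sigma>. 0 < \<sigma> \<Longrightarrow> card {n. s n = \<sigma>} = h2.dim (E \<sigma>)" "summable (\<lambda>n. (s n)\<^sup>2)"
    by (rule decreasing_rearrangement[OF bound]) blast+
  have "singular_value_seq ?T s"
    unfolding singular_value_seq_def h2_adjoint_matrix_operator[OF hs] using s by (simp add: E_def)
  then show ?thesis using that s(5) by blast
qed

text \<open>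
  The singular values are eventually below \<open>1\<close>, where the power with the larger exponent is smaller.
\<close>

lemma hilbert_schmidt_in_schatten_class:
  assumes hs: "hilbert_schmidt_matrix b" and q: "2 \<le> q"
  shows "matrix_operator b \<in> schatten_class q"
proof -
  obtain s where s: "singular_value_seq (matrix_operator b) s" "summable (\<lambda>n. (s n)\<^sup>2)"
    using hilbert_schmidt_singular_values[OF hs] .
  have lim: "s \<longlonglongrightarrow> 0" and nn: "\<And>n. 0 \<le> s n"
    using s(1) by (auto simp: singular_value_seq_def)
  have "\<forall>\<^sub>F n in sequentially. s n < 1" using order_tendstoD(2)[OF lim, of 1] by simp
  then have "\<forall>\<^sub>F n in sequentially. norm (s n powr q) \<le> (s n)\<^sup>2"
  proof eventually_elim
    case (elim n)
    show ?case
    proof (cases "s n = 0")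
      case False
      then have "0 < s n" using nn[of n] by simp
      then have "s n powr q \<le> s n powr 2" using q elim by (intro powr_mono') auto
      then show ?thesis using \<open>0 < s n\<close> by (simp add: powr_numeral)
    qed simp
  qed
  then have "summable (\<lambda>n. s n powr q)"
    using s(2) by (rule summable_comparison_test_ev)
  then show ?thesis
    using compact_matrix_operator[OF hs] s(1) by (auto simp: schatten_class_def)
qed

section \<open>Composition operators with symbols in a sector\<close>

lemma summable_square_nat_powr:
  assumes "1/2 < Re s"
  shows "summable (\<lambda>m. (cmod (of_nat m powr - s))\<^sup>2)"
proof -
  have "(cmod (of_nat m powr - s))\<^sup>2 = real m powr (- 2 * Re s)" for m
    unfolding norm_nat_powr power2_eq_square powr_add[symmetric] by simp
  then show ?thesis using assms by (simp add: summable_real_powr_iff)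
qed

lemma h2_abs_convergent_at:
  assumes "1/2 < \<kappa>"
  shows "abs_convergent_at \<kappa> (h2_coeff f)"
  using summable_mult_square_summable[OF summable_h2_coeff[of f] summable_square_nat_powr[of "of_real \<kappa>"]] assms
  by (simp add: abs_convergent_at_def norm_mult norm_nat_powr)

lemma h2_eval_sums:
  assumes "1/2 < Re s"
  shows "dirichlet_term (h2_coeff f) s sums h2_eval f s"
proof -
  have "summable (\<lambda>n. norm (dirichlet_term (h2_coeff f) s n))"
    using h2_abs_convergent_at[OF assms, of f] by (simp add: abs_convergent_at_def norm_dirichlet_term)
  then have "summable (dirichlet_term (h2_coeff f) s)"
    by (rule summable_norm_cancel)
  then show ?thesis
    unfolding h2_eval_def by (rule summable_sums)
qed

lemma holomorphic_h2_eval: "h2_eval f holomorphic_on right_half_plane (1/2)"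
proof (rule holomorphic_uniform_sequence[OF open_right_half_plane])
  show "(\<lambda>s. \<Sum>m<N. dirichlet_term (h2_coeff f) s m) holomorphic_on right_half_plane (1/2)" for N
    unfolding dirichlet_term_def by (intro holomorphic_intros)
  fix x assume x: "x \<in> right_half_plane (1/2)"
  define d where "d = (Re x - 1/2) / 2"
  have d: "0 < d" using x by (simp add: d_def)
  have ge: "1/2 + d \<le> Re s" if "s \<in> cball x d" for s
    using that abs_Re_le_cmod[of "x - s"] by (simp add: d_def dist_norm field_simps)
  have "uniform_limit (cball x d) (\<lambda>N s. \<Sum>m<N. dirichlet_term (h2_coeff f) s m)
      (\<lambda>s. \<Sum>m. dirichlet_term (h2_coeff f) s m) sequentially"
  proof (rule Weierstrass_m_test)
    show "norm (dirichlet_term (h2_coeff f) s m) \<le> norm (h2_coeff f m) * real m powr - (1/2 + d)"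
      if "s \<in> cball x d" for m s
      unfolding norm_dirichlet_term using ge[OF that] by (intro mult_left_mono nat_powr_antimono) auto
    show "summable (\<lambda>m. norm (h2_coeff f m) * real m powr - (1/2 + d))"
      using h2_abs_convergent_at[of "1/2 + d" f] d by (simp add: abs_convergent_at_def)
  qed
  moreover have "cball x d \<subseteq> right_half_plane (1/2)"
    using ge d by fastforce
  ultimately show "\<exists>d>0. cball x d \<subseteq> right_half_plane (1/2) \<and>
      uniform_limit (cball x d) (\<lambda>N s. \<Sum>m<N. dirichlet_term (h2_coeff f) s m) (h2_eval f) sequentially"
    using d unfolding h2_eval_def by blast
qed

text \<open>
  Elements are determined by their values, since absolute convergence on \<open>Re s = 1\<close> lets the mean value
  formula recover the coefficients. Hence the description defining \<open>composition_operator\<close> has at most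
  one solution.
\<close>

lemma h2_eval_inject:
  assumes "\<And>s. 1/2 < Re s \<Longrightarrow> h2_eval f s = h2_eval g s"
  shows "f = g"
proof (rule h2_eqI)
  fix n
  show "h2_coeff f n = h2_coeff g n"
  proof (cases "n = 0")
    case False
    show ?thesis
    proof (rule dirichlet_coefficients_unique[where \<kappa> = 1 and F = "h2_eval f"])
      show "dirichlet_term (h2_coeff f) s sums h2_eval f s" if "1 \<le> Re s" for s
        by (rule h2_eval_sums) (use that in simp)
      show "dirichlet_term (h2_coeff g) s sums h2_eval f s" if "1 \<le> Re s" for s
        using that assms[of s] h2_eval_sums[of s g] by simp
      show "continuous_on UNIV (\<lambda>t. h2_eval f (Complex 1 t))"
        by (rule continuous_on_vertical_line[OF holomorphic_h2_eval]) simp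
    qed (use False in \<open>auto intro: h2_abs_convergent_at\<close>)
  qed simp
qed

lemma h2_eval_matrix_operator:
  assumes hs: "hilbert_schmidt_matrix b" and s: "1/2 < Re s"
  shows "h2_eval (matrix_operator b f) s = (\<Sum>n. h2_coeff f n * (\<Sum>m. dirichlet_term (b n) s m))"
proof -
  have "h2_eval (matrix_operator b f) s = (\<Sum>m. (\<Sum>n. h2_coeff f n * b n m) * of_nat m powr - s)"
    unfolding h2_eval_def dirichlet_term_def h2_coeff_matrix_operator[OF hs]
    by (simp add: h2_cinner_def h2_coeff_column[OF hs])
  also have "\<dots> = (\<Sum>n. h2_coeff f n * (\<Sum>m. b n m * of_nat m powr - s))"
    by (rule bilinear_form_swap[OF hs summable_h2_coeff summable_square_nat_powr[OF s], symmetric])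
  finally show ?thesis by (simp add: dirichlet_term_def)
qed

text \<open>
  A row of the matrix has square summable coefficients, so its series represents a holomorphic function
  on the half-plane \<open>Re s > 1/2\<close>. It agrees with \<open>F\<close> far to the right, hence by the identity theorem
  wherever both are defined.
\<close>

lemma square_summable_row_eval:
  assumes hs: "hilbert_schmidt_matrix b" and hol: "F holomorphic_on right_half_plane (1/2)"
    and sums: "\<And>s. \<kappa> \<le> Re s \<Longrightarrow> dirichlet_term (b n) s sums F s" and s: "1/2 < Re s"
  shows "(\<Sum>m. dirichlet_term (b n) s m) = F s"
proof -
  define r where "r = conj_column (conj_transpose b) n"
  have r: "h2_coeff r = b n"
    using h2_coeff_column[OF hilbert_schmidt_conj_transpose[OF hs]] by (simp add: r_def conj_transpose_def fun_eq_iff)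
  define \<kappa>' where "\<kappa>' = max \<kappa> (1/2)"
  have "h2_eval r s = F s"
  proof (rule analytic_continuation_open[of "right_half_plane \<kappa>'" "right_half_plane (1/2)" "h2_eval r" F])
    have "complex_of_real (\<kappa>' + 1) \<in> right_half_plane \<kappa>'" by simp
    then show "right_half_plane \<kappa>' \<noteq> {}" by blast
    show "h2_eval r z = F z" if "z \<in> right_half_plane \<kappa>'" for z
      using that sums[of z] unfolding h2_eval_def r by (simp add: sums_iff \<kappa>'_def)
  qed (use s in \<open>auto intro: open_right_half_plane convex_connected convex_right_half_plane holomorphic_h2_eval hol simp: \<kappa>'_def\<close>)
  then show ?thesis by (simp add: h2_eval_def r)
qed

lemma hilbert_schmidt_matrixI:
  assumes z: "\<And>m. b 0 m = 0" "\<And>n. b n 0 = 0"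
    and bound: "\<And>N. (\<Sum>n=1..N. \<Sum>m=1..N. (cmod (b n m))\<^sup>2) \<le> C"
  shows "hilbert_schmidt_matrix b"
  unfolding hilbert_schmidt_matrix_def
proof (intro conjI allI z)
  show "(\<lambda>(n, m). (cmod (b n m))\<^sup>2) summable_on UNIV"
  proof (rule nonneg_bdd_above_summable_on)
    show "bdd_above (sum (\<lambda>(n, m). (cmod (b n m))\<^sup>2) ` {F. F \<subseteq> UNIV \<and> finite F})"
    proof (rule bdd_aboveI2)
      fix F :: "(nat \<times> nat) set" assume "F \<in> {F. F \<subseteq> UNIV \<and> finite F}"
      then have F: "finite F" by simp
      then obtain N where N: "\<forall>x\<in>fst ` F \<union> snd ` F. x \<le> N"
        using finite_nat_set_iff_bounded_le[of "fst ` F \<union> snd ` F"] by auto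
      have "(\<Sum>(n, m)\<in>F. (cmod (b n m))\<^sup>2) = (\<Sum>(n, m)\<in>F \<inter> {1..N} \<times> {1..N}. (cmod (b n m))\<^sup>2)"
      proof (rule sum.mono_neutral_right[OF F])
        show "\<forall>p\<in>F - F \<inter> {1..N} \<times> {1..N}. (case p of (n, m) \<Rightarrow> (cmod (b n m))\<^sup>2) = 0"
        proof
          fix p assume p: "p \<in> F - F \<inter> {1..N} \<times> {1..N}"
          then have "fst p \<le> N" "snd p \<le> N" using N by auto
          with p have "fst p = 0 \<or> snd p = 0" by (cases p) auto
          then show "(case p of (n, m) \<Rightarrow> (cmod (b n m))\<^sup>2) = 0"
            using z by (auto simp: case_prod_unfold)
        qed
      qed auto
      also have "\<dots> \<le> (\<Sum>(n, m)\<in>{1..N} \<times> {1..N}. (cmod (b n m))\<^sup>2)"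
        by (rule sum_mono2) auto
      also have "\<dots> = (\<Sum>n=1..N. \<Sum>m=1..N. (cmod (b n m))\<^sup>2)"
        by (simp add: sum.cartesian_product)
      also have "\<dots> \<le> C" by (rule bound)
      finally show "(\<Sum>(n, m)\<in>F. (cmod (b n m))\<^sup>2) \<le> C" .
    qed
  qed auto
qed

text \<open>
  The rows of the matrix are the coefficients of \<open>n powr - \<phi> s\<close>, and \<open>composition_matrix_bound\<close> makes
  the whole matrix square summable.
\<close>

theorem composition_operator_hilbert_schmidt:
  assumes G0: "\<phi> \<in> symbol_class_G0"
    and sector: "\<And>s. 0 < Re s \<Longrightarrow> norm (\<phi> s - 1/2) \<le> K * Re (\<phi> s - 1/2)" and K: "1 \<le> K"
  obtains b where "hilbert_schmidt_matrix b" "composition_operator \<phi> = matrix_operator b"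
proof -
  from G0 have hol: "\<phi> holomorphic_on right_half_plane 0"
    and gt: "\<And>s. 0 < Re s \<Longrightarrow> 1/2 < Re (\<phi> s)"
    by (auto simp: symbol_class_G0_def image_subset_iff)
  from G0 obtain c \<sigma> where "0 \<le> \<sigma>"
    and "\<forall>s\<in>right_half_plane \<sigma>. dirichlet_term c s sums \<phi> s"
    unfolding symbol_class_G0_def by blast
  then have c: "dirichlet_term c s sums \<phi> s" if "\<sigma> < Re s" for s
    using that by simp
  define \<kappa> where "\<kappa> = \<sigma> + 3"
  have abs: "abs_convergent_at \<kappa> c"
    unfolding \<kappa>_def by (rule abs_convergent_at_of_convergent) (use c in \<open>auto simp: sums_iff\<close>)
  have sums: "dirichlet_term c s sums \<phi> s" if "\<kappa> \<le> Re s" for s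
    using that c by (simp add: \<kappa>_def)
  have "0 < \<kappa>" using \<open>0 \<le> \<sigma>\<close> by (simp add: \<kappa>_def)
  have "\<exists>a. abs_convergent_at \<kappa> a \<and> (\<forall>s. \<kappa> \<le> Re s \<longrightarrow> dirichlet_term a s sums exp (- of_real (ln (real n)) * \<phi> s))" for n
    using exp_dirichlet_series[OF abs sums] by metis
  then obtain a where a: "\<And>n. abs_convergent_at \<kappa> (a n)"
    "\<And>n s. \<kappa> \<le> Re s \<Longrightarrow> dirichlet_term (a n) s sums exp (- of_real (ln (real n)) * \<phi> s)"
    by metis
  \<comment> \<open>Neither change affects a Dirichlet series with index \<open>n > 0\<close>: its term with \<open>m = 0\<close> vanishes anyway.\<close>
  define b where "b n m = (if n = 0 \<or> m = 0 then 0 else a n m)" for n m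
  have b_abs: "abs_convergent_at \<kappa> (b n)" for n
    using a(1)[of n] unfolding abs_convergent_at_def
    by (rule summable_comparison_test'[where N = 0]) (simp add: b_def)
  have b_sums: "dirichlet_term (b n) s sums of_nat n powr - \<phi> s" if "0 < n" "\<kappa> \<le> Re s" for n s
  proof -
    have "dirichlet_term (b n) s = dirichlet_term (a n) s"
      using that by (auto simp: fun_eq_iff dirichlet_term_def b_def)
    moreover have "exp (- of_real (ln (real n)) * \<phi> s) = of_nat n powr - \<phi> s"
      using that by (simp add: powr_def mult.commute)
    ultimately show ?thesis using a(2)[OF that(2), of n] by simp
  qed
  obtain \<rho> \<delta> where \<rho>: "\<kappa> \<le> \<rho>" "1 \<le> \<rho>" "0 < \<delta>" "\<And>s. Re s = \<rho> \<Longrightarrow> 1/2 + \<delta> \<le> Re (\<phi> s)"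
  proof (rule dirichlet_bounded_below_on_line[OF abs sums])
    show "1/2 < Re (\<phi> s)" if "\<kappa> \<le> Re s" for s using gt[of s] that \<open>0 < \<kappa>\<close> by simp
  qed auto
  have hs: "hilbert_schmidt_matrix b"
    by (rule hilbert_schmidt_matrixI[OF _ _ composition_matrix_bound[OF hol gt sector K b_abs b_sums \<rho>(2-4)]])
      (auto simp: b_def)
  have row: "(\<Sum>m. dirichlet_term (b n) s m) = of_nat n powr - \<phi> s" if "0 < n" "1/2 < Re s" for n s
  proof (rule square_summable_row_eval[OF hs _ b_sums[OF that(1)] that(2)])
    show "(\<lambda>s. of_nat n powr - \<phi> s) holomorphic_on right_half_plane (1/2)"
      by (intro holomorphic_intros holomorphic_on_subset[OF hol]) auto
  qed
  have eval: "h2_eval (matrix_operator b f) s = h2_eval f (\<phi> s)" if "1/2 < Re s" for f s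
  proof -
    have "h2_coeff f n * (\<Sum>m. dirichlet_term (b n) s m) = dirichlet_term (h2_coeff f) (\<phi> s) n" for n
      using row[of n s] that by (cases "n = 0") (auto simp: dirichlet_term_def)
    then show ?thesis
      unfolding h2_eval_matrix_operator[OF hs that] by (simp add: h2_eval_def)
  qed
  have "composition_operator \<phi> f = matrix_operator b f" for f
    unfolding composition_operator_def
  proof (rule the_equality)
    show "\<forall>s\<in>right_half_plane (1/2). h2_eval (matrix_operator b f) s = h2_eval f (\<phi> s)"
      using eval by simp
    show "g = matrix_operator b f" if "\<forall>s\<in>right_half_plane (1/2). h2_eval g s = h2_eval f (\<phi> s)" for g
      by (rule h2_eval_inject) (use that eval in simp)
  qed
  then have "composition_operator \<phi> = matrix_operator b" by blast
  with hs show ?thesis using that by blast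
qed

lemma norm_le_Re_of_Arg_less:
  assumes z: "\<bar>Arg z\<bar> < \<beta>" and \<beta>: "\<beta> < pi / 2"
  shows "norm z \<le> 1 / cos \<beta> * Re z"
proof (cases "z = 0")
  case False
  have cos: "0 < cos \<beta>" using assms by (intro cos_gt_zero_pi) auto
  have "Re z = norm z * cos (Arg z)"
    using cos_Arg[OF False] False by simp
  moreover have "cos \<beta> \<le> cos (Arg z)"
    using cos_monotone_0_pi_le[of "\<bar>Arg z\<bar>" \<beta>] assms by (simp add: cos_abs_real)
  ultimately have "norm z * cos \<beta> \<le> Re z"
    by (simp add: mult_left_mono)
  then show ?thesis using cos by (simp add: field_simps)
qed simp

theorem theorem1p3:
  fixes \<phi> :: "complex \<Rightarrow> complex" and \<alpha> :: real
  assumes "\<phi> \<in> symbol_class_G0"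
    and "\<alpha> > 1"
    and "\<phi> ` right_half_plane 0 \<subseteq>
           {s \<in> right_half_plane (1/2). \<bar>Arg (s - 1/2)\<bar> < pi / (2 * \<alpha>)}"
  shows "compact_operator_h2 (composition_operator \<phi>) \<and>
    (\<alpha> \<le> 2 \<longrightarrow>
      (\<forall>p. p > 1 / (\<alpha> - 1) \<longrightarrow> composition_operator \<phi> \<in> schatten_class (2 * p)))"
proof -
  let ?\<beta> = "pi / (2 * \<alpha>)"
  have \<beta>: "0 < ?\<beta>" "?\<beta> < pi / 2" using assms(2) by (auto simp: field_simps)
  have "0 < cos ?\<beta>" using \<beta> by (intro cos_gt_zero_pi) auto
  then have K: "1 \<le> 1 / cos ?\<beta>" by simp
  have sector: "norm (\<phi> s - 1/2) \<le> 1 / cos ?\<beta> * Re (\<phi> s - 1/2)" if "0 < Re s" for s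
  proof (rule norm_le_Re_of_Arg_less[OF _ \<beta>(2)])
    show "\<bar>Arg (\<phi> s - 1/2)\<bar> < ?\<beta>" using assms(3) that by (auto simp: image_subset_iff)
  qed
  obtain b where b: "hilbert_schmidt_matrix b" "composition_operator \<phi> = matrix_operator b"
    using composition_operator_hilbert_schmidt[OF assms(1) sector K] .
  have "matrix_operator b \<in> schatten_class (2 * p)" if "\<alpha> \<le> 2" "1 / (\<alpha> - 1) < p" for p
  proof (rule hilbert_schmidt_in_schatten_class[OF b(1)])
    have "1 \<le> 1 / (\<alpha> - 1)" using assms(2) that(1) by simp
    then show "2 \<le> 2 * p" using that(2) by simp
  qed
  then show ?thesis
    using compact_matrix_operator[OF b(1)] unfolding b(2) by blast
qed

end
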